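(* Let $k\ge 1$, $\alpha_k>0$ and $\psi_h^{k-1}\in W_h$. In the setting described in the context (in particular, the finite-dimensional spaces $V_h\subset V$ and $W_h\subset W$ satisfy the discrete inf-sup condition), the nonlinear saddle point problem: find $(u_h^k,\psi_h^k)\in V_h\times W_h$ such that $$\alpha_k\, a(u_h^k,v_h)+b(v_h,\psi_h^k-\psi_h^{k-1})=\alpha_k F(v_h)\quad\text{for all } v_h\in V_h,$$ $$b(u_h^k,w_h)-(\nabla\mathcal R^*(\psi_h^k),w_h)_{\Omega_d}=0\quad\text{for all } w_h\in W_h,$$ admits a unique solution pair $(u_h^k,\psi_h^k)\in V_h\times W_h$.
   Context: Setting. $\Omega\subset\mathbb R^n$ ($n\in\{1,2,3\}$) is an open bounded polygonal/polyhedral domain. $\Omega_d\subset\overline\Omega$ is a Hausdorff-measurable set of Hausdorff dimension $d\le n$ with Hausdorff measure $\mathcal H_d$ (coinciding with the induced surface measure), and $(\cdot,\cdot)_{\Omega_d}$ is the $L^2(\Omega_d)$ inner product. $V$ is a real Hilbert space with dual $V'$; $B:V\to Q$ is a surjective bounded linear map whose image $Q$ (a Hilbert space) is continuously and densely embedded in $L^2(\Omega_d;\mathbb R^m)$. For a.e. $x\in\Omega_d$, $C(x)\subset\mathbb R^m$ is a closed convex set with nonempty interior. Set $\mathcal O=\{o\in L^2(\Omega_d;\mathbb R^m): o(x)\in C(x)\text{ for a.e. }x\in\Omega_d\}$ and $K=\{v\in V: Bv\in\mathcal O\}$, assumed closed, convex, nonempty. The bilinear form $a$ on $V$ is symmetric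 with $a(u,u)\ge\nu\|u\|_V^2$ and $a(u,v)\le M\|u\|_V\|v\|_V$ for constants $\nu,M>0$; $F\in V'$. Let $W=L^\infty(\Omega_d;\mathbb R^m)$, regarded as a subset of $Q'$ via $\langle w,q\rangle=(w,q)_{\Omega_d}$, and $b(v,w)=(Bv,w)_{\Omega_d}$. Legendre function. A function $L:\mathbb R^m\to\mathbb R\cup\{+\infty\}$ is Legendre if it is proper with $\operatorname{int}(\operatorname{dom}L)\ne\emptyset$, strictly convex and differentiable on $\operatorname{int}(\operatorname{dom}L)$, with singular gradient on the boundary of $\operatorname{dom}L$. Let $R:\Omega_d\times\mathbb R^m\to\mathbb R\cup\{+\infty\}$ be Carathéodory with $R(x,\cdot)$ Legendre, $\operatorname{dom}R(x,\cdot)=C(x)$, and $R(x,y)/|y|\to\infty$ as $|y|\to\infty$, for a.e. $x$. Put $\mathcal R(w)(x)=R(x,w(x))$, $\nabla\mathcal R(w)(x)=\partial_uR(x,w(x))$, and assume $\mathcal R:\mathcal O\to L^1(\Omega_d)$ is continuous ($\mathcal O$ with the $L^2$ topology). Let $R^*(x,z)=\sup_{y\in\mathbb R^m}\{z\cdot y-R(x,y)\}$, $\mathcal R^*(\psi)(x)=R^*(x,\psi(x))$, $\nabla\mathcal R^*(\psi)(x)=\partial_zR^*(x,\psi(x))$. Then $\mathcal R^*:W\to L^1(\Omega_d)$, $\nabla\mathcal R^*:W\to\mathcal O$ is continuous, and $\nabla\mathcal R^*=(\nabla\mathcal R)^{-1}$. Discrete spaces. $V_h\subset V$ and $W_h\subset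 W$ are finite-dimensional subspaces satisfying the discrete inf-sup condition $$\inf_{w\in W_h}\sup_{v\in V_h}\frac{b(v,w)}{\|v\|_V\|w\|_{Q'}}=\beta_h>\beta_0$$ for a mesh-independent constant $\beta_0>0$. *)

theory Defs
  imports "HOL-Analysis.Analysis" "HOL-Probability.Essential_Supremum"
begin

section \<open>Hausdorff measure and Hausdorff dimension\<close>

text \<open>The weight of a covering set is \<open>\<omega>\<^sub>d (diam U / 2)\<^sup>d\<close>, where \<open>\<omega>\<^sub>d\<close> is the volume of the
  \<open>d\<close>-dimensional unit ball. With this normalisation the Hausdorff measure of integer dimension
  is the induced surface measure on smooth or piecewise flat sets (and the counting measure for
  \<open>d = 0\<close>). The case \<open>d = 0\<close> is separate because \<open>0 powr 0 = 0\<close>.\<close>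

definition hausdorff_weight :: "real \<Rightarrow> 'a::metric_space set \<Rightarrow> ennreal" where
  "hausdorff_weight d U =
     (if U = {} then 0 else if d = 0 then 1
      else ennreal (unit_ball_vol d * (diameter U / 2) powr d))"

text \<open>Covering sets are required to be bounded, since \<^const>\<open>diameter\<close> is unspecified otherwise.\<close>

definition hausdorff_premeasure :: "real \<Rightarrow> real \<Rightarrow> 'a::metric_space set \<Rightarrow> ennreal" where
  "hausdorff_premeasure d \<delta> A =
     (INF U \<in> {U :: nat \<Rightarrow> 'a set. A \<subseteq> (\<Union>i. U i) \<and> (\<forall>i. bounded (U i) \<and> diameter (U i) \<le> \<delta>)}.
        \<Sum>i. hausdorff_weight d (U i))"

definition hausdorff_outer :: "real \<Rightarrow> 'a::metric_space set \<Rightarrow> ennreal" where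
  "hausdorff_outer d A = (SUP \<delta>\<in>{0<..}. hausdorff_premeasure d \<delta> A)"

definition hausdorff_measure :: "real \<Rightarrow> 'a::metric_space measure" where
  "hausdorff_measure d =
     measure_of UNIV (lambda_system UNIV UNIV (hausdorff_outer d)) (hausdorff_outer d)"

definition hausdorff_dim :: "'a::metric_space set \<Rightarrow> real" where
  "hausdorff_dim A = Inf {s. 0 \<le> s \<and> hausdorff_outer s A = 0}"

lemma hausdorff_premeasure_empty: "hausdorff_premeasure d \<delta> {} = 0" if "0 < \<delta>"
proof -
  have "hausdorff_premeasure d \<delta> ({} :: 'a set) \<le> (\<Sum>i::nat. hausdorff_weight d ({} :: 'a set))"
    unfolding hausdorff_premeasure_def using that
    by (intro INF_lower2[where i = "\<lambda>_. {}"]) auto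
  then show ?thesis by (simp add: hausdorff_weight_def)
qed

lemma hausdorff_premeasure_mono:
  "A \<subseteq> B \<Longrightarrow> hausdorff_premeasure d \<delta> A \<le> hausdorff_premeasure d \<delta> B"
  unfolding hausdorff_premeasure_def by (intro INF_superset_mono) auto

lemma hausdorff_premeasure_subadditive:
  fixes A :: "nat \<Rightarrow> 'a::metric_space set"
  shows "hausdorff_premeasure d \<delta> (\<Union>i. A i) \<le> (\<Sum>i. hausdorff_premeasure d \<delta> (A i))"
proof (rule ennreal_le_epsilon)
  let ?h = "\<lambda>S::'a set. hausdorff_premeasure d \<delta> S"
  fix e :: real
  assume fin: "(\<Sum>i. ?h (A i)) < top" and e: "0 < e"
  have fin_i: "?h (A i) < top" for i
    using fin by (rule ennreal_suminf_lessD)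
  have "\<exists>U. A i \<subseteq> (\<Union>j. U j) \<and> (\<forall>j. bounded (U j) \<and> diameter (U j) \<le> \<delta>) \<and>
          (\<Sum>j. hausdorff_weight d (U j)) \<le> ?h (A i) + ennreal (e * (1/2) ^ Suc i)"
    for i :: nat
  proof -
    have "?h (A i) < ?h (A i) + ennreal (e * (1/2) ^ Suc i)"
      using fin_i[of i] e ennreal_add_left_cancel_less[of "?h (A i)" 0] by (auto simp: less_top)
    from this[unfolded hausdorff_premeasure_def[of d \<delta> "A i"] INF_less_iff]
    obtain U where "A i \<subseteq> (\<Union>j. U j)" "\<forall>j. bounded (U j) \<and> diameter (U j) \<le> \<delta>"
       "(\<Sum>j. hausdorff_weight d (U j)) < ?h (A i) + ennreal (e * (1/2) ^ Suc i)"
      unfolding hausdorff_premeasure_def[of d \<delta> "A i"] by blast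
    then show ?thesis by (intro exI[of _ U]) auto
  qed
  then obtain U where U: "\<And>i. A i \<subseteq> (\<Union>j. U i j)"
      "\<And>i j. bounded (U i j)" "\<And>i j. diameter (U i j) \<le> \<delta>"
      "\<And>i. (\<Sum>j. hausdorff_weight d (U i j)) \<le> ?h (A i) + ennreal (e * (1/2) ^ Suc i)"
    by metis
  define V where "V k = (case prod_decode k of (i, j) \<Rightarrow> U i j)" for k
  have cov: "(\<Union>i. A i) \<subseteq> (\<Union>k. V k)"
  proof
    fix x assume "x \<in> (\<Union>i. A i)"
    then obtain i j where "x \<in> U i j" using U(1) by blast
    then have "x \<in> V (prod_encode (i, j))" by (simp add: V_def)
    then show "x \<in> (\<Union>k. V k)" by blast
  qed
  have "?h (\<Union>i. A i) \<le> (\<Sum>k. hausdorff_weight d (V k))"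
    unfolding hausdorff_premeasure_def
    by (rule INF_lower) (use cov U in \<open>auto simp: V_def split: prod.splits\<close>)
  also have "\<dots> = (\<Sum>i. \<Sum>j. hausdorff_weight d (U i j))"
    by (subst suminf_ennreal_2dimen[where f = "\<lambda>(i, j). hausdorff_weight d (U i j)", symmetric])
       (auto simp: V_def comp_def split: prod.splits intro!: suminf_cong)
  also have "\<dots> \<le> (\<Sum>i. ?h (A i) + ennreal (e * (1/2) ^ Suc i))"
    by (intro suminf_le U) auto
  also have "\<dots> = (\<Sum>i. ?h (A i)) + (\<Sum>i. ennreal (e * (1/2) ^ Suc i))"
    by (simp add: suminf_add)
  also have "(\<Sum>i. ennreal (e * (1/2) ^ Suc i)) = ennreal e"
  proof (rule suminf_ennreal_eq)
    show "(\<lambda>i. e * (1/2) ^ Suc i) sums e"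
      using sums_mult[OF power_half_series, of e] by simp
  qed (use e in auto)
  finally show "?h (\<Union>i. A i) \<le> (\<Sum>i. ?h (A i)) + ennreal e" .
qed

lemma outer_measure_space_hausdorff_outer: "outer_measure_space UNIV (hausdorff_outer d)"
proof -
  have sub: "hausdorff_outer d (\<Union>i. A i) \<le> (\<Sum>i. hausdorff_outer d (A i))"
    for A :: "nat \<Rightarrow> 'a set"
    unfolding hausdorff_outer_def[of d "\<Union>i. A i"]
  proof (rule SUP_least)
    fix \<delta> :: real assume "\<delta> \<in> {0<..}"
    then have "hausdorff_premeasure d \<delta> (A i) \<le> hausdorff_outer d (A i)" for i
      unfolding hausdorff_outer_def by (rule SUP_upper)
    then have "(\<Sum>i. hausdorff_premeasure d \<delta> (A i)) \<le> (\<Sum>i. hausdorff_outer d (A i))"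
      by (intro suminf_le) auto
    with hausdorff_premeasure_subadditive[of d \<delta> A]
    show "hausdorff_premeasure d \<delta> (\<Union>i. A i) \<le> (\<Sum>i. hausdorff_outer d (A i))" by simp
  qed
  have "hausdorff_outer d ({} :: 'a set) = 0"
    by (simp add: hausdorff_outer_def hausdorff_premeasure_empty cong: SUP_cong_simp)
  moreover have "hausdorff_outer d A \<le> hausdorff_outer d B" if "A \<subseteq> B" for A B :: "'a set"
    unfolding hausdorff_outer_def by (intro SUP_mono' hausdorff_premeasure_mono that)
  ultimately show ?thesis
    using sub unfolding outer_measure_space_def positive_def increasing_def countably_subadditive_def
    by auto
qed

lemma measure_space_hausdorff_outer:
  "measure_space (UNIV :: 'a::metric_space set) (lambda_system UNIV UNIV (hausdorff_outer d)) (hausdorff_outer d)"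
proof -
  interpret sigma_algebra "UNIV :: 'a set" UNIV
    using sigma_algebra_Pow[of "UNIV :: 'a set"] by simp
  show ?thesis
    using caratheodory_lemma[OF outer_measure_space_hausdorff_outer] by simp
qed

lemma space_hausdorff_measure: "space (hausdorff_measure d) = UNIV"
  unfolding hausdorff_measure_def by (simp add: space_measure_of_conv)

lemma sets_hausdorff_measure:
  "sets (hausdorff_measure d) = lambda_system UNIV UNIV (hausdorff_outer d)"
  unfolding hausdorff_measure_def
  by (rule sigma_algebra.sets_measure_of_eq[OF conjunct1[OF measure_space_hausdorff_outer[unfolded measure_space_def]]])

lemma emeasure_hausdorff_measure:
  assumes "A \<in> sets (hausdorff_measure d)"
  shows "emeasure (hausdorff_measure d) A = hausdorff_outer d A"
  using measure_space_hausdorff_outer[unfolded measure_space_def] assms[unfolded sets_hausdorff_measure]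
  unfolding hausdorff_measure_def by (blast intro: emeasure_measure_of_sigma)


section \<open>Polygonal and polyhedral domains\<close>

text \<open>In dimension one the facets are points, in dimension two segments, in dimension three
  convex polygons; a nonconvex face is the union of several facets.\<close>

definition polyhedral_domain :: "'a::euclidean_space set \<Rightarrow> bool" where
  "polyhedral_domain \<Omega> \<longleftrightarrow>
     open \<Omega> \<and> connected \<Omega> \<and> \<Omega> \<noteq> {} \<and> bounded \<Omega> \<and>
     (\<exists>\<F>. finite \<F> \<and> (\<forall>P\<in>\<F>. polytope P \<and> aff_dim P = int DIM('a) - 1) \<and> frontier \<Omega> = \<Union>\<F>)"


section \<open>Lebesgue spaces\<close>

text \<open>Elements of the Lebesgue spaces are represented by measurable functions; two functions
  represent the same element iff they agree almost everywhere.\<close>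

definition L2_space :: "'a measure \<Rightarrow> ('a \<Rightarrow> 'b::euclidean_space) set" where
  "L2_space M = {f \<in> borel_measurable M. integrable M (\<lambda>x. (norm (f x))\<^sup>2)}"

definition L2_inner :: "'a measure \<Rightarrow> ('a \<Rightarrow> 'b::euclidean_space) \<Rightarrow> ('a \<Rightarrow> 'b) \<Rightarrow> real" where
  "L2_inner M f g = (\<integral>x. f x \<bullet> g x \<partial>M)"

definition L2_norm :: "'a measure \<Rightarrow> ('a \<Rightarrow> 'b::euclidean_space) \<Rightarrow> real" where
  "L2_norm M f = sqrt (L2_inner M f f)"

definition L1_space :: "'a measure \<Rightarrow> ('a \<Rightarrow> real) set" where
  "L1_space M = {f. integrable M f}"

definition L1_norm :: "'a measure \<Rightarrow> ('a \<Rightarrow> real) \<Rightarrow> real" where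
  "L1_norm M f = (\<integral>x. \<bar>f x\<bar> \<partial>M)"

definition Linf_space :: "'a measure \<Rightarrow> ('a \<Rightarrow> 'b::euclidean_space) set" where
  "Linf_space M = {f \<in> borel_measurable M. esssup M (\<lambda>x. ereal (norm (f x))) < \<infinity>}"

definition Linf_norm :: "'a measure \<Rightarrow> ('a \<Rightarrow> 'b::euclidean_space) \<Rightarrow> real" where
  "Linf_norm M f = real_of_ereal (esssup M (\<lambda>x. ereal (norm (f x))))"

definition continuous_wrt_norms ::
    "(('a \<Rightarrow> 'b::ab_group_add) \<Rightarrow> real) \<Rightarrow> (('a \<Rightarrow> 'c::ab_group_add) \<Rightarrow> real) \<Rightarrow>
     ('a \<Rightarrow> 'b) set \<Rightarrow> (('a \<Rightarrow> 'b) \<Rightarrow> ('a \<Rightarrow> 'c)) \<Rightarrow> bool" where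
  "continuous_wrt_norms nX nY S T \<longleftrightarrow>
     (\<forall>f\<in>S. \<forall>e>0. \<exists>\<delta>>0. \<forall>g\<in>S.
        nX (\<lambda>x. g x - f x) < \<delta> \<longrightarrow> nY (\<lambda>x. T g x - T f x) < e)"

text \<open>\<open>\<iota>\<close> maps a Hilbert space linearly, injectively and continuously onto a dense subspace of
  \<open>L\<^sup>2\<close>.\<close>

definition dense_L2_embedding ::
    "'a measure \<Rightarrow> ('q::real_normed_vector \<Rightarrow> ('a \<Rightarrow> 'b::euclidean_space)) \<Rightarrow> bool" where
  "dense_L2_embedding M \<iota> \<longleftrightarrow>
     (\<forall>q. \<iota> q \<in> L2_space M) \<and>
     (\<forall>p q. AE x in M. \<iota> (p + q) x = \<iota> p x + \<iota> q x) \<and>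
     (\<forall>c q. AE x in M. \<iota> (c *\<^sub>R q) x = c *\<^sub>R \<iota> q x) \<and>
     (\<forall>q. (AE x in M. \<iota> q x = 0) \<longrightarrow> q = 0) \<and>
     (\<exists>c. \<forall>q. L2_norm M (\<iota> q) \<le> c * norm q) \<and>
     (\<forall>f\<in>L2_space M. \<forall>e>0. \<exists>q. L2_norm M (\<lambda>x. f x - \<iota> q x) < e)"

text \<open>A finite-dimensional subspace of \<open>L\<^sup>\<infinity>\<close>, given as the set of all representatives of its
  elements.\<close>

definition fin_dim_Linf_subspace :: "'a measure \<Rightarrow> ('a \<Rightarrow> 'b::euclidean_space) set \<Rightarrow> bool" where
  "fin_dim_Linf_subspace M S \<longleftrightarrow>
     (\<exists>G. finite G \<and> G \<subseteq> Linf_space M \<and>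
        S = {w \<in> Linf_space M. \<exists>c. AE x in M. w x = (\<Sum>g\<in>G. c g *\<^sub>R g x)})"

definition fin_dim_subspace :: "'v::real_vector set \<Rightarrow> bool" where
  "fin_dim_subspace S \<longleftrightarrow> (\<exists>G. finite G \<and> S = span G)"


section \<open>Legendre functions\<close>

definition effective_domain :: "('b \<Rightarrow> ereal) \<Rightarrow> 'b set" where
  "effective_domain L = {y. L y < \<infinity>}"

definition grad :: "('b::real_inner \<Rightarrow> real) \<Rightarrow> 'b \<Rightarrow> 'b" where
  "grad f y = (THE g. GDERIV f y :> g)"

text \<open>The last conjunct is the singularity of the gradient at the boundary of the domain
  (essential smoothness).\<close>

definition Legendre_function :: "('b::euclidean_space \<Rightarrow> ereal) \<Rightarrow> bool" where
  "Legendre_function L \<longleftrightarrow>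
     (let D = interior (effective_domain L); l = (\<lambda>y. real_of_ereal (L y)) in
       (\<forall>y. L y \<noteq> -\<infinity>) \<and> (\<exists>y. L y \<noteq> \<infinity>) \<and>
       D \<noteq> {} \<and>
       (\<forall>y\<in>D. \<forall>z\<in>D. \<forall>t. y \<noteq> z \<longrightarrow> 0 < t \<longrightarrow> t < 1 \<longrightarrow>
          L ((1 - t) *\<^sub>R y + t *\<^sub>R z) < ereal (1 - t) * L y + ereal t * L z) \<and>
       (\<forall>y\<in>D. l differentiable (at y)) \<and>
       (\<forall>s y. (\<forall>i. s i \<in> D) \<and> s \<longlonglongrightarrow> y \<and> y \<in> frontier (effective_domain L) \<longrightarrow>
          filterlim (\<lambda>i::nat. norm (grad l (s i))) at_top sequentially))"

definition convex_conjugate :: "('b::real_inner \<Rightarrow> ereal) \<Rightarrow> 'b \<Rightarrow> ereal" where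
  "convex_conjugate L z = (SUP y. ereal (z \<bullet> y) - L y)"

text \<open>Continuity in the second argument is relative to the effective domain: an extended-valued
  function that is finite on a closed set \<open>C \<noteq> UNIV\<close> and \<open>\<infinity>\<close> off it is never continuous on the
  whole space.\<close>

definition Caratheodory_function :: "'a measure \<Rightarrow> ('a \<Rightarrow> 'b::topological_space \<Rightarrow> ereal) \<Rightarrow> bool" where
  "Caratheodory_function M R \<longleftrightarrow>
     (\<forall>y. (\<lambda>x. R x y) \<in> borel_measurable M) \<and>
     (AE x in M. continuous_on (effective_domain (R x)) (R x))"

definition superposition :: "('a \<Rightarrow> 'b \<Rightarrow> ereal) \<Rightarrow> ('a \<Rightarrow> 'b) \<Rightarrow> 'a \<Rightarrow> real" where
  "superposition R w x = real_of_ereal (R x (w x))"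

definition grad_conjugate ::
    "('a \<Rightarrow> 'b::real_inner \<Rightarrow> ereal) \<Rightarrow> ('a \<Rightarrow> 'b) \<Rightarrow> 'a \<Rightarrow> 'b" where
  "grad_conjugate R \<psi> x = grad (\<lambda>z. real_of_ereal (convex_conjugate (R x) z)) (\<psi> x)"


section \<open>The discrete problem\<close>

definition feasible_observables ::
    "'a measure \<Rightarrow> ('a \<Rightarrow> 'b::euclidean_space set) \<Rightarrow> ('a \<Rightarrow> 'b) set" where
  "feasible_observables M C = {f \<in> L2_space M. AE x in M. f x \<in> C x}"

definition coupling_form ::
    "'a measure \<Rightarrow> ('q \<Rightarrow> 'a \<Rightarrow> 'b::euclidean_space) \<Rightarrow> ('v \<Rightarrow> 'q) \<Rightarrow> 'v \<Rightarrow> ('a \<Rightarrow> 'b) \<Rightarrow> real" where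
  "coupling_form M \<iota> B v w = L2_inner M (\<iota> (B v)) w"

definition Q_dual_norm ::
    "'a measure \<Rightarrow> ('q::real_normed_vector \<Rightarrow> 'a \<Rightarrow> 'b::euclidean_space) \<Rightarrow> ('a \<Rightarrow> 'b) \<Rightarrow> real" where
  "Q_dual_norm M \<iota> w = onorm (\<lambda>q. L2_inner M w (\<iota> q))"

text \<open>Infimum and supremum range over nonzero elements. For \<open>Wh = 0\<close> the value is \<open>\<infinity>\<close>.\<close>

definition inf_sup_constant ::
    "'a measure \<Rightarrow> ('q::real_normed_vector \<Rightarrow> 'a \<Rightarrow> 'b::euclidean_space) \<Rightarrow>
     ('v::real_normed_vector \<Rightarrow> 'q) \<Rightarrow> 'v set \<Rightarrow> ('a \<Rightarrow> 'b) set \<Rightarrow> ereal" where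
  "inf_sup_constant M \<iota> B Vh Wh =
     (INF w \<in> {w \<in> Wh. \<not> (AE x in M. w x = 0)}. SUP v \<in> Vh - {0}.
        ereal (coupling_form M \<iota> B v w / (norm v * Q_dual_norm M \<iota> w)))"

definition solves_saddle_point ::
    "'a measure \<Rightarrow> ('q \<Rightarrow> 'a \<Rightarrow> 'b::euclidean_space) \<Rightarrow> ('v \<Rightarrow> 'q) \<Rightarrow> ('v \<Rightarrow> 'v \<Rightarrow> real) \<Rightarrow> ('v \<Rightarrow> real) \<Rightarrow>
     ('a \<Rightarrow> 'b \<Rightarrow> ereal) \<Rightarrow> 'v set \<Rightarrow> ('a \<Rightarrow> 'b) set \<Rightarrow> real \<Rightarrow> ('a \<Rightarrow> 'b) \<Rightarrow> 'v \<Rightarrow> ('a \<Rightarrow> 'b) \<Rightarrow> bool" where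
  "solves_saddle_point M \<iota> B a F R Vh Wh \<alpha> \<psi>\<^sub>0 u \<psi> \<longleftrightarrow>
     (\<forall>v\<in>Vh. \<alpha> * a u v + coupling_form M \<iota> B v (\<lambda>x. \<psi> x - \<psi>\<^sub>0 x) = \<alpha> * F v) \<and>
     (\<forall>w\<in>Wh. coupling_form M \<iota> B u w - L2_inner M (grad_conjugate R \<psi>) w = 0)"

end

theory Submission
  imports Defs
begin

text \<open>
  Eliminating the primal variable leaves a dual problem for the latent variable. Let \<open>x\<close> represent
  \<open>b(\<cdot>, \<psi>)\<close> on \<open>Vh\<close> with respect to \<open>a\<close>. By the inf-sup condition \<open>\<psi>\<close> is determined by \<open>x\<close>,
  so the dual problem lives on a finite-dimensional subspace \<open>X\<close> of the Hilbert space. There it is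
  the critical point equation of \<open>x \<mapsto> \<integral> R\<^sup>*(\<psi>\<^sub>x) + a(x, x) / (2\<alpha>) - a(p, x)\<close> for a
  fixed \<open>p\<close>, which is strongly convex, so minimising sequences are Cauchy. The integral of \<open>R\<^sup>*(\<psi>)\<close> is finite because \<open>R\<^sup>*(\<psi>)\<close> equals
  \<open>\<psi> \<cdot> \<nabla>R\<^sup>*(\<psi>) - R(\<nabla>R\<^sup>*(\<psi>))\<close> and \<open>\<nabla>R\<^sup>*(\<psi>)\<close> is feasible. This uses that \<open>\<nabla>R\<^sup>*(x, z)\<close> is the
  maximizer of \<open>z \<cdot> y - R(x, y)\<close>: by the blow-up of the gradient every maximizer is interior, hence
  unique, and then it depends continuously on \<open>z\<close>, so that the conjugate is differentiable.
  Uniqueness follows from the monotonicity of \<open>\<nabla>R\<^sup>*\<close>, coercivity and the inf-sup condition.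
\<close>

section \<open>Strongly convex minimisation in Hilbert space\<close>

lemma orthogonal_expansion:
  fixes C :: "'v::real_inner set"
  assumes "finite C" "pairwise orthogonal C" "x \<in> span C"
  shows "x = (\<Sum>e\<in>C. (x \<bullet> e / (e \<bullet> e)) *\<^sub>R e)"
  using assms(3)
proof (induction rule: span_induct)
  case base
  show ?case
    unfolding subspace_def mem_Collect_eq
  proof (intro conjI allI impI ballI)
    show "0 = (\<Sum>e\<in>C. (0 \<bullet> e / (e \<bullet> e)) *\<^sub>R e)" by simp
  next
    fix x y
    assume "x \<in> {x. x = (\<Sum>e\<in>C. (x \<bullet> e / (e \<bullet> e)) *\<^sub>R e)}"
      and "y \<in> {x. x = (\<Sum>e\<in>C. (x \<bullet> e / (e \<bullet> e)) *\<^sub>R e)}"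
    then have "x + y = (\<Sum>e\<in>C. (x \<bullet> e / (e \<bullet> e)) *\<^sub>R e) + (\<Sum>e\<in>C. (y \<bullet> e / (e \<bullet> e)) *\<^sub>R e)"
      by simp
    also have "\<dots> = (\<Sum>e\<in>C. ((x + y) \<bullet> e / (e \<bullet> e)) *\<^sub>R e)"
      by (simp add: sum.distrib inner_add_left add_divide_distrib scaleR_add_left)
    finally show "x + y = (\<Sum>e\<in>C. ((x + y) \<bullet> e / (e \<bullet> e)) *\<^sub>R e)" .
  next
    fix c :: real and x
    assume "x \<in> {x. x = (\<Sum>e\<in>C. (x \<bullet> e / (e \<bullet> e)) *\<^sub>R e)}"
    then have "c *\<^sub>R x = c *\<^sub>R (\<Sum>e\<in>C. (x \<bullet> e / (e \<bullet> e)) *\<^sub>R e)"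
      by simp
    also have "\<dots> = (\<Sum>e\<in>C. (c *\<^sub>R x \<bullet> e / (e \<bullet> e)) *\<^sub>R e)"
      by (simp add: scaleR_sum_right)
    finally show "c *\<^sub>R x = (\<Sum>e\<in>C. (c *\<^sub>R x \<bullet> e / (e \<bullet> e)) *\<^sub>R e)" .
  qed
next
  case (step x)
  \<comment> \<open>Orthogonality removes every term with \<open>e \<noteq> x\<close>. For
    \<open>x = 0\<close> the convention \<open>0 / 0 = 0\<close> leaves the summand
    \<open>0\<close>, which is again \<open>x\<close>.\<close>
  have "(\<Sum>e\<in>C. (x \<bullet> e / (e \<bullet> e)) *\<^sub>R e) = (\<Sum>e\<in>C. if e = x then x else 0)"
    using assms(2) step
    by (intro sum.cong) (auto simp: pairwise_def orthogonal_def inner_commute)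
  then show ?case
    using assms(1) step by simp
qed

text \<open>After orthogonalisation the span is the fixed-point set of a continuous map, the
  orthogonal projection. This argument works in an ambient space of any dimension.\<close>

lemma closed_span_finite_real_inner:
  fixes B :: "'v::real_inner set"
  assumes "finite B"
  shows "closed (span B)"
proof -
  obtain C where C: "finite C" "span C = span B" "pairwise orthogonal C"
    using basis_orthogonal[OF assms] by blast
  have "span C = {x. x = (\<Sum>e\<in>C. (x \<bullet> e / (e \<bullet> e)) *\<^sub>R e)}"
  proof (intro set_eqI iffI; clarsimp)
    fix x assume "x \<in> span C"
    then show "x = (\<Sum>e\<in>C. (x \<bullet> e / (e \<bullet> e)) *\<^sub>R e)"
      using orthogonal_expansion C by blast
  next
    fix x assume x: "x = (\<Sum>e\<in>C. (x \<bullet> e / (e \<bullet> e)) *\<^sub>R e)"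
    have "(\<Sum>e\<in>C. (x \<bullet> e / (e \<bullet> e)) *\<^sub>R e) \<in> span C"
      by (intro span_sum span_scale span_base)
    with x show "x \<in> span C" by simp
  qed
  moreover have "closed {x. x = (\<Sum>e\<in>C. (x \<bullet> e / (e \<bullet> e)) *\<^sub>R e)}"
    unfolding divide_inverse by (intro closed_Collect_eq continuous_intros)
  ultimately show ?thesis
    using C(2) by simp
qed

text \<open>\<open>D x\<close> acts as a subgradient with a quadratic gain. The limit of a
  minimising sequence attains the infimum because the affine lower bound taken at the limit itself
  passes to the limit. Continuity of \<open>D\<close> along rays then turns minimality into the
  critical point equation.\<close>

lemma strongly_convex_critical_point:
  fixes J :: "'v::{real_inner, complete_space} \<Rightarrow> real" and D :: "'v \<Rightarrow> 'v \<Rightarrow> real"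
  assumes X: "subspace X" "closed X" and \<kappa>: "0 < \<kappa>"
    and bl: "\<And>x. x \<in> X \<Longrightarrow> bounded_linear (D x)"
    and strong: "\<And>x y. x \<in> X \<Longrightarrow> y \<in> X \<Longrightarrow> J x + D x (y - x) + \<kappa> * (norm (y - x))\<^sup>2 \<le> J y"
    and hemi: "\<And>x h. x \<in> X \<Longrightarrow> h \<in> X \<Longrightarrow> ((\<lambda>t. D (x + t *\<^sub>R h) h) \<longlongrightarrow> D x h) (at_right 0)"
  shows "\<exists>x\<in>X. \<forall>h\<in>X. D x h = 0"
proof -
  have X0: "0 \<in> X" using X(1) by (rule subspace_0)
  obtain c where c: "\<And>y. norm (D 0 y) \<le> norm y * c"
    using bounded_linear.bounded[OF bl[OF X0]] by blast
  \<comment> \<open>Completing the square: \<open>- c\<^sup>2 / (4 * \<kappa>)\<close> is the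
    minimum over \<open>r\<close> of \<open>\<kappa> * r\<^sup>2 - c * r\<close>, with
    \<open>r = norm y\<close>.\<close>
  have "J 0 - c\<^sup>2 / (4 * \<kappa>) \<le> J y" if "y \<in> X" for y
  proof -
    have "c\<^sup>2 / (4 * \<kappa>) - c * norm y + \<kappa> * (norm y)\<^sup>2 = (c - 2 * \<kappa> * norm y)\<^sup>2 / (4 * \<kappa>)"
      using \<kappa> by (simp add: field_simps power2_eq_square)
    also have "\<dots> \<ge> 0" using \<kappa> by simp
    finally have "c\<^sup>2 / (4 * \<kappa>) - c * norm y + \<kappa> * (norm y)\<^sup>2 \<ge> 0" .
    moreover have "- D 0 y \<le> norm y * c" using c[of y] by simp
    moreover have "J 0 + D 0 y + \<kappa> * (norm y)\<^sup>2 \<le> J y" using strong[OF X0 that] by simp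
    ultimately show ?thesis by (simp add: mult.commute)
  qed
  then have bdd: "bdd_below (J ` X)" by (intro bdd_belowI2)
  define m where "m = Inf (J ` X)"
  have m: "m \<le> J y" if "y \<in> X" for y
    unfolding m_def using bdd that by (intro cInf_lower) auto
  have "\<exists>x. x \<in> X \<and> J x < m + 1 / real (Suc n)" for n
    using cInf_lessD[of "J ` X" "m + 1 / real (Suc n)"] X0 unfolding m_def by auto
  then obtain s where s: "\<And>n. s n \<in> X" "\<And>n. J (s n) < m + 1 / real (Suc n)"
    by metis
  \<comment> \<open>Strong convexity is used at the midpoint \<open>z\<close> towards
    \<open>x\<close> and towards \<open>y\<close>. The linear terms are opposite and cancel, and
    each quadratic term is \<kappa>/4 times the squared distance of \<open>x\<close> and
    \<open>y\<close>.\<close>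
  have half: "\<kappa> / 2 * (norm (y - x))\<^sup>2 \<le> J x + J y - 2 * m" if "x \<in> X" "y \<in> X" for x y
  proof -
    define z where "z = (1/2) *\<^sub>R (x + y)"
    have z: "z \<in> X" unfolding z_def by (intro subspace_scale subspace_add X that)
    have e: "x - z = (1/2) *\<^sub>R (x - y)" "y - z = - ((1/2) *\<^sub>R (x - y))"
      by (simp_all add: z_def algebra_simps flip: scaleR_left.add)
    have 1: "D z (y - z) = - D z (x - z)"
      unfolding e using linear_neg[OF bounded_linear.linear[OF bl[OF z]]] by blast
    have 2: "norm (x - z) = norm (y - x) / 2" "norm (y - z) = norm (y - x) / 2"
      unfolding e by (simp_all add: norm_minus_commute)
    show ?thesis
      using strong[OF z that(1)] strong[OF z that(2)] m[OF z]
      unfolding 1 2 by (simp add: power_divide)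
  qed
  have "Cauchy s"
  proof (rule CauchyI)
    fix e :: real assume e: "0 < e"
    \<comment> \<open>From index \<open>N\<close> on both values exceed \<open>m\<close> by less
      than \<open>1 / (N + 1)\<close>, so \<open>half\<close> needs
      \<open>2 / (N + 1) < \<kappa> / 2 * e\<^sup>2\<close>.\<close>
    obtain N where N: "4 / (\<kappa> * e\<^sup>2) < real N" using reals_Archimedean2 by blast
    have N': "4 < real (Suc N) * (\<kappa> * e\<^sup>2)"
      using N e \<kappa> by (simp add: divide_less_eq algebra_simps) (smt (verit) mult_pos_pos zero_less_power)
    have "norm (s i - s j) < e" if "N \<le> i" "N \<le> j" for i j
    proof -
      have "1 / real (Suc i) \<le> 1 / real (Suc N)" "1 / real (Suc j) \<le> 1 / real (Suc N)"
        using that by (auto intro!: divide_left_mono)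
      then have "\<kappa> / 2 * (norm (s i - s j))\<^sup>2 < 2 / real (Suc N)"
        using half[OF s(1)[of j] s(1)[of i]] s(2)[of i] s(2)[of j] by simp
      also have "\<dots> < \<kappa> / 2 * e\<^sup>2"
        using N' by (simp add: divide_less_eq algebra_simps)
      finally have "(norm (s i - s j))\<^sup>2 < e\<^sup>2" using \<kappa> by simp
      then show ?thesis using e by (simp add: power2_less_imp_less)
    qed
    then show "\<exists>N. \<forall>i\<ge>N. \<forall>j\<ge>N. norm (s i - s j) < e" by blast
  qed
  then obtain x where x: "s \<longlonglongrightarrow> x"
    using Cauchy_convergent_iff convergent_def by blast
  have xX: "x \<in> X" using closed_sequentially[OF X(2)] s(1) x by blast
  interpret Dx: bounded_linear "D x" by (rule bl[OF xX])
  have "(\<lambda>n. m + 1 / real (Suc n) - D x (s n - x)) \<longlonglongrightarrow> m + 0 - D x (x - x)"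
    using LIMSEQ_inverse_real_of_nat
    by (intro tendsto_intros x Dx.tendsto) (simp add: inverse_eq_divide)
  then have lim: "(\<lambda>n. m + 1 / real (Suc n) - D x (s n - x)) \<longlonglongrightarrow> m"
    by (simp add: Dx.zero)
  have "J x \<le> m + 1 / real (Suc n) - D x (s n - x)" for n
    using strong[OF xX s(1)[of n]] s(2)[of n] \<kappa> by (smt (verit) mult_nonneg_nonneg zero_le_power2)
  then have Jx: "J x \<le> m"
    by (intro LIMSEQ_le_const[OF lim]) auto
  \<comment> \<open>The subgradient inequality at \<open>x + t *\<^sub>R h\<close>, tested at the
    minimiser \<open>x\<close>, gives a sign for \<open>D (x + t *\<^sub>R h) h\<close>; the sign
    survives as \<open>t\<close> tends to \<open>0\<close> from the right.\<close>
  have ge: "0 \<le> D x h" if "h \<in> X" for h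
  proof (rule tendsto_lowerbound[OF hemi[OF xX that]])
    show "\<forall>\<^sub>F t in at_right 0. 0 \<le> D (x + t *\<^sub>R h) h"
      unfolding eventually_at_right_field
    proof (intro exI[of _ 1] conjI allI impI)
      fix t :: real assume t: "0 < t" "t < 1"
      let ?y = "x + t *\<^sub>R h"
      have y: "?y \<in> X" using X(1) xX that by (simp add: subspace_add subspace_scale)
      interpret Dy: bounded_linear "D ?y" by (rule bl[OF y])
      have "D ?y (x - ?y) = - (t * D ?y h)"
        using Dy.neg[of "t *\<^sub>R h"] Dy.scaleR[of t h] by simp
      moreover have "J ?y + D ?y (x - ?y) \<le> J x"
        using strong[OF y xX] \<kappa> by (smt (verit) mult_nonneg_nonneg zero_le_power2)
      ultimately have "0 \<le> t * D ?y h" using m[OF y] Jx by simp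
      then show "0 \<le> D ?y h" using t by (simp add: zero_le_mult_iff)
    qed simp
  qed simp
  have "D x h = 0" if "h \<in> X" for h
    using ge[OF that] ge[of "- h"] subspace_neg[OF X(1) that] Dx.neg[of h] by simp
  then show ?thesis using xX by blast
qed


section \<open>Conjugates of supercoercive Legendre functions\<close>

lemma grad_eqI:
  assumes "GDERIV f y :> g"
  shows "grad f y = g"
  unfolding grad_def
proof (rule the_equality[where P = "\<lambda>g. GDERIV f y :> g", OF assms])
  fix g' assume "GDERIV f y :> g'"
  then have "(\<lambda>h. h \<bullet> g') = (\<lambda>h. h \<bullet> g)"
    using assms unfolding gderiv_def by (rule has_derivative_unique)
  then have "(g' - g) \<bullet> g' = (g' - g) \<bullet> g" by meson
  then have "(g' - g) \<bullet> (g' - g) = 0" by (simp add: inner_diff_right)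
  then show "g' = g" by simp
qed

lemma GDERIV_grad:
  fixes f :: "'b::euclidean_space \<Rightarrow> real"
  assumes "f differentiable (at y)"
  shows "GDERIV f y :> grad f y"
proof -
  obtain f' where f': "(f has_derivative f') (at y)"
    using assms unfolding differentiable_def by blast
  have "f' = (\<lambda>h. h \<bullet> adjoint f' 1)"
    using adjoint_works[OF has_derivative_linear[OF f'], of _ 1] by auto
  then have "GDERIV f y :> adjoint f' 1"
    unfolding gderiv_def using f' by simp
  then show ?thesis using grad_eqI by metis
qed

text \<open>The difference quotients along the segment from \<open>y\<close> to \<open>z\<close> are
  bounded by \<open>f z - f y\<close> through convexity, and they converge to the directional
  derivative at \<open>y\<close>.\<close>

lemma convex_on_above_gradient:
  fixes f :: "'b::real_inner \<Rightarrow> real"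
  assumes "convex_on D f" "GDERIV f y :> g" "y \<in> D" "z \<in> D"
  shows "(z - y) \<bullet> g \<le> f z - f y"
proof -
  have "((\<lambda>t::real. y + t *\<^sub>R (z - y)) has_derivative (\<lambda>t. t *\<^sub>R (z - y))) (at 0)"
    by (auto intro!: derivative_eq_intros)
  moreover have "(f has_derivative (\<lambda>h. h \<bullet> g)) (at (y + 0 *\<^sub>R (z - y)))"
    using assms(2) unfolding gderiv_def by simp
  ultimately have "((\<lambda>t. f (y + t *\<^sub>R (z - y))) has_derivative (\<lambda>t. (t *\<^sub>R (z - y)) \<bullet> g)) (at (0::real))"
    using has_derivative_compose by fast
  then have "((\<lambda>t. f (y + t *\<^sub>R (z - y))) has_real_derivative (z - y) \<bullet> g) (at 0)"
    unfolding has_field_derivative_def by (simp add: mult_commute_abs)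
  then have "((\<lambda>t. (f (y + t *\<^sub>R (z - y)) - f y) / t) \<longlongrightarrow> (z - y) \<bullet> g) (at 0)"
    by (simp add: has_field_derivative_iff)
  then have "((\<lambda>t. (f (y + t *\<^sub>R (z - y)) - f y) / t) \<longlongrightarrow> (z - y) \<bullet> g) (at_right 0)"
    by (rule tendsto_within_subset) simp
  moreover have "\<forall>\<^sub>F t in at_right 0. (f (y + t *\<^sub>R (z - y)) - f y) / t \<le> f z - f y"
    unfolding eventually_at_right_field
  proof (intro exI[of _ 1] conjI allI impI)
    fix t :: real assume t: "0 < t" "t < 1"
    have "f ((1 - t) *\<^sub>R y + t *\<^sub>R z) \<le> (1 - t) * f y + t * f z"
      using convex_onD[OF assms(1), of t y z] t assms(3,4) by simp
    moreover have "(1 - t) *\<^sub>R y + t *\<^sub>R z = y + t *\<^sub>R (z - y)" by (simp add: algebra_simps)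
    ultimately have "f (y + t *\<^sub>R (z - y)) - f y \<le> (f z - f y) * t"
      by (simp add: algebra_simps)
    then show "(f (y + t *\<^sub>R (z - y)) - f y) / t \<le> f z - f y"
      using t by (simp add: divide_le_eq)
  qed simp
  ultimately show ?thesis by (rule tendsto_upperbound) simp
qed

text \<open>The situation at one fixed point of the domain of integration: \<open>L\<close> stands
  for \<open>R x\<close>, for almost every \<open>x\<close>.\<close>

locale supercoercive_Legendre =
  fixes L :: "'b::euclidean_space \<Rightarrow> ereal"
  assumes Legendre: "Legendre_function L"
    and closed_dom: "closed (effective_domain L)"
    and convex_dom: "convex (effective_domain L)"
    and cont: "continuous_on (effective_domain L) L"
    and supercoercive: "((\<lambda>y. L y / ereal (norm y)) \<longlongrightarrow> \<infinity>) at_infinity"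
begin

abbreviation "domL \<equiv> effective_domain L"

definition "l y = real_of_ereal (L y)"

text \<open>Competitors are restricted to \<open>domL\<close>, where \<open>L\<close> is finite.
  Outside, \<open>l\<close> takes the default value \<open>0\<close>, which carries no
  information.\<close>

definition "maximizer z y \<longleftrightarrow> y \<in> domL \<and> (\<forall>y'\<in>domL. z \<bullet> y' - l y' \<le> z \<bullet> y - l y)"

lemma L_neq_MInfty: "L y \<noteq> -\<infinity>"
  using Legendre unfolding Legendre_function_def Let_def by (elim conjE) (rule spec)

lemma L_eq: "y \<in> domL \<Longrightarrow> L y = ereal (l y)"
  using L_neq_MInfty[of y] unfolding effective_domain_def l_def by (cases "L y") auto

lemma L_eq_infinity: "y \<notin> domL \<Longrightarrow> L y = \<infinity>"
  unfolding effective_domain_def by simp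

lemma continuous_on_l: "continuous_on domL l"
proof -
  have "\<bar>L y\<bar> \<noteq> \<infinity>" if "y \<in> domL" for y
    using L_eq[OF that] by simp
  then have "continuous_on domL (real_of_ereal \<circ> L)"
    using continuous_on_iff_real[of domL L] cont by blast
  then show ?thesis by (simp add: comp_def l_def[abs_def])
qed

lemma l_strictly_convex:
  assumes "y \<in> interior domL" "z \<in> interior domL" "y \<noteq> z" "0 < t" "t < 1"
  shows "l ((1 - t) *\<^sub>R y + t *\<^sub>R z) < (1 - t) * l y + t * l z"
proof -
  have "(1 - t) *\<^sub>R y + t *\<^sub>R z \<in> interior domL"
    using convex_interior[OF convex_dom] assms by (auto simp: convex_alt)
  then have "(1 - t) *\<^sub>R y + t *\<^sub>R z \<in> domL" "y \<in> domL" "z \<in> domL"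
    using assms interior_subset by blast+
  moreover have "L ((1 - t) *\<^sub>R y + t *\<^sub>R z) < ereal (1 - t) * L y + ereal t * L z"
    using Legendre assms unfolding Legendre_function_def Let_def by blast
  ultimately show ?thesis by (simp add: L_eq)
qed

lemma convex_on_l: "convex_on (interior domL) l"
proof (rule convex_onI)
  fix t :: real and x y assume "0 < t" "t < 1" "x \<in> interior domL" "y \<in> interior domL"
  then show "l ((1 - t) *\<^sub>R x + t *\<^sub>R y) \<le> (1 - t) * l x + t * l y"
    using l_strictly_convex[of x y t] by (cases "x = y") (auto simp: algebra_simps simp flip: scaleR_add_left)
qed (use convex_interior convex_dom in auto)

lemma GDERIV_l:
  assumes "y \<in> interior domL"
  shows "GDERIV l y :> grad l y"
proof -
  have "\<forall>y\<in>interior domL. l differentiable (at y)"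
    using Legendre unfolding Legendre_function_def Let_def l_def[abs_def] by (elim conjE)
  then show ?thesis using assms GDERIV_grad by blast
qed

lemma grad_l_blowup:
  assumes "\<And>i. s i \<in> interior domL" "s \<longlonglongrightarrow> y" "y \<in> frontier domL"
  shows "filterlim (\<lambda>i::nat. norm (grad l (s i))) at_top sequentially"
proof -
  have "\<forall>s y. (\<forall>i. s i \<in> interior domL) \<and> s \<longlonglongrightarrow> y \<and> y \<in> frontier domL \<longrightarrow>
      filterlim (\<lambda>i::nat. norm (grad l (s i))) at_top sequentially"
    using Legendre unfolding Legendre_function_def Let_def l_def[abs_def] by (elim conjE)
  then show ?thesis using assms by blast
qed

lemma interior_dom_nonempty: "interior domL \<noteq> {}"
  using Legendre unfolding Legendre_function_def Let_def by (elim conjE)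

section \<open>Superlinear growth; existence, location and uniqueness of maximizers\<close>

lemma superlinear: "\<exists>r. \<forall>y\<in>domL. r \<le> norm y \<longrightarrow> c * norm y \<le> l y"
proof -
  have "\<forall>\<^sub>F y in at_infinity. ereal c < L y / ereal (norm y)"
    using supercoercive unfolding tendsto_PInfty by blast
  then obtain b where b: "\<And>y. b \<le> norm y \<Longrightarrow> ereal c < L y / ereal (norm y)"
    unfolding eventually_at_infinity by blast
  \<comment> \<open>The lower bound \<open>1\<close> makes \<open>norm y\<close> positive, so that
    the quotient can be multiplied out.\<close>
  have "c * norm y \<le> l y" if "y \<in> domL" "max b 1 \<le> norm y" for y
  proof -
    have "0 < norm y" using that(2) by linarith
    moreover from this have "ereal c < ereal (l y / norm y)"
      using b[of y] that by (simp add: L_eq)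
    ultimately show ?thesis by (simp add: less_divide_eq)
  qed
  then show ?thesis by blast
qed

text \<open>Superlinearity is used with slope \<open>norm z + 2\<close>, one more than the bound on
  \<open>norm z'\<close>; the surplus \<open>norm y\<close> is what gets estimated. One radius
  serves all \<open>z'\<close> near \<open>z\<close>, which \<open>maximizer_continuous\<close>
  relies on.\<close>

lemma superlevel_bounded:
  assumes "y\<^sub>1 \<in> domL"
  shows "\<exists>r. \<forall>z'. norm (z' - z) \<le> 1 \<longrightarrow>
     (\<forall>y\<in>domL. z' \<bullet> y\<^sub>1 - l y\<^sub>1 \<le> z' \<bullet> y - l y \<longrightarrow> norm y \<le> r)"
proof -
  obtain r where r: "\<And>y. y \<in> domL \<Longrightarrow> r \<le> norm y \<Longrightarrow> (norm z + 2) * norm y \<le> l y"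
    using superlinear by blast
  have "norm y \<le> max r ((norm z + 1) * norm y\<^sub>1 + l y\<^sub>1)"
    if z': "norm (z' - z) \<le> 1" and y: "y \<in> domL" and le: "z' \<bullet> y\<^sub>1 - l y\<^sub>1 \<le> z' \<bullet> y - l y" for z' y
  proof (cases "r \<le> norm y")
    case True
    have nz: "norm z' \<le> norm z + 1"
      using z' norm_triangle_ineq2[of z' z] by simp
    have "z' \<bullet> y \<le> (norm z + 1) * norm y"
      using norm_cauchy_schwarz[of z' y] mult_right_mono[OF nz, of "norm y"] by simp
    moreover have "- (z' \<bullet> y\<^sub>1) \<le> (norm z + 1) * norm y\<^sub>1"
      using norm_cauchy_schwarz[of "- z'" y\<^sub>1] mult_right_mono[OF nz, of "norm y\<^sub>1"] by simp
    ultimately show ?thesis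
      using r[OF y True] le by (simp add: algebra_simps)
  qed simp
  then show ?thesis by blast
qed

text \<open>All points at least as good as \<open>y\<^sub>1\<close> lie in one ball, so a maximum
  over the compact part of \<open>domL\<close> in that ball is a maximum over
  \<open>domL\<close>.\<close>

lemma maximizer_exists: "\<exists>y. maximizer z y"
proof -
  obtain y\<^sub>1 where y\<^sub>1: "y\<^sub>1 \<in> domL" using interior_dom_nonempty interior_subset by blast
  obtain r where r: "\<And>y. y \<in> domL \<Longrightarrow> z \<bullet> y\<^sub>1 - l y\<^sub>1 \<le> z \<bullet> y - l y \<Longrightarrow> norm y \<le> r"
    using superlevel_bounded[OF y\<^sub>1, of z] by force
  have "compact (domL \<inter> cball 0 r)"
    using closed_dom by (simp add: closed_Int_compact)
  moreover have "y\<^sub>1 \<in> domL \<inter> cball 0 r" using y\<^sub>1 r[OF y\<^sub>1] by simp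
  moreover have "continuous_on (domL \<inter> cball 0 r) (\<lambda>y. z \<bullet> y - l y)"
    by (intro continuous_intros continuous_on_subset[OF continuous_on_l]) auto
  ultimately obtain y where y: "y \<in> domL \<inter> cball 0 r"
    and max: "\<And>y'. y' \<in> domL \<inter> cball 0 r \<Longrightarrow> z \<bullet> y' - l y' \<le> z \<bullet> y - l y"
    using continuous_attains_sup[of "domL \<inter> cball 0 r" "\<lambda>y. z \<bullet> y - l y"] by blast
  have "z \<bullet> y' - l y' \<le> z \<bullet> y - l y" if "y' \<in> domL" for y'
  proof (cases "z \<bullet> y\<^sub>1 - l y\<^sub>1 \<le> z \<bullet> y' - l y'")
    case True
    then show ?thesis using max[of y'] r[OF that] that by simp
  next
    case False
    then show ?thesis using max[of y\<^sub>1] \<open>y\<^sub>1 \<in> domL \<inter> cball 0 r\<close> by simp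
  qed
  then show ?thesis using y unfolding maximizer_def by blast
qed

text \<open>Towards a maximizer on the frontier, along a segment from an interior point \<open>y\<^sub>1\<close>, the slope
  of \<open>l\<close> would stay bounded in the direction of the segment; comparing with the values of \<open>l\<close> on
  a ball around \<open>y\<^sub>1\<close> then bounds the whole gradient.\<close>

lemma maximizer_interior:
  assumes "maximizer z y\<^sub>0"
  shows "y\<^sub>0 \<in> interior domL"
proof (rule ccontr)
  assume not_int: "y\<^sub>0 \<notin> interior domL"
  have y\<^sub>0: "y\<^sub>0 \<in> domL" and max: "\<And>y. y \<in> domL \<Longrightarrow> z \<bullet> y - l y \<le> z \<bullet> y\<^sub>0 - l y\<^sub>0"
    using assms unfolding maximizer_def by auto
  have front: "y\<^sub>0 \<in> frontier domL"
    using y\<^sub>0 not_int closed_dom by (simp add: frontier_def)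
  obtain y\<^sub>1 where y\<^sub>1: "y\<^sub>1 \<in> interior domL" using interior_dom_nonempty by blast
  define w where "w = y\<^sub>1 - y\<^sub>0"
  define Y where "Y t = y\<^sub>0 + t *\<^sub>R w" for t :: real
  have Y_int: "Y t \<in> interior domL" if "0 < t" "t \<le> 1" for t
    using mem_interior_convex_shrink[OF convex_dom y\<^sub>1 y\<^sub>0 that]
    by (simp add: Y_def w_def algebra_simps)
  have Y_tendsto: "s \<longlonglongrightarrow> 0 \<Longrightarrow> (\<lambda>n. Y (s n)) \<longlonglongrightarrow> y\<^sub>0" for s
    unfolding Y_def by (auto intro!: tendsto_eq_intros)
  define s where "s n = 1 / real (Suc n)" for n
  have s0: "s \<longlonglongrightarrow> 0"
    using LIMSEQ_inverse_real_of_nat by (simp add: s_def[abs_def] inverse_eq_divide)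
  have s: "0 < s n" "s n \<le> 1" for n by (auto simp: s_def)
  \<comment> \<open>The tangent inequality at \<open>Y t\<close> is available only against interior
    points, so \<open>y\<^sub>0\<close> is reached as the limit of \<open>Y (s n)\<close>.
    Maximality of \<open>y\<^sub>0\<close> bounds the increment of \<open>l\<close> by that of the
    linear function \<open>z\<close>.\<close>
  have slope: "z \<bullet> w \<le> w \<bullet> grad l (Y t)" if t: "0 < t" "t \<le> 1" for t
  proof -
    have Yd: "Y t \<in> domL" using Y_int[OF t] interior_subset by blast
    have "(\<lambda>n. l (Y (s n)) - l (Y t)) \<longlonglongrightarrow> l y\<^sub>0 - l (Y t)"
      using Y_int s interior_subset
      by (intro tendsto_intros continuous_on_tendsto_compose[OF continuous_on_l Y_tendsto[OF s0] y\<^sub>0]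
            always_eventually allI) blast
    moreover have "(\<lambda>n. (Y (s n) - Y t) \<bullet> grad l (Y t)) \<longlonglongrightarrow> (y\<^sub>0 - Y t) \<bullet> grad l (Y t)"
      by (intro tendsto_intros Y_tendsto s0)
    moreover have "(Y (s n) - Y t) \<bullet> grad l (Y t) \<le> l (Y (s n)) - l (Y t)" for n
      by (rule convex_on_above_gradient[OF convex_on_l GDERIV_l]) (use Y_int t s in auto)
    ultimately have "(y\<^sub>0 - Y t) \<bullet> grad l (Y t) \<le> l y\<^sub>0 - l (Y t)"
      by (meson LIMSEQ_le)
    moreover have "l y\<^sub>0 - l (Y t) \<le> z \<bullet> (y\<^sub>0 - Y t)"
      using max[OF Yd] by (simp add: inner_diff_right)
    ultimately have "t * (z \<bullet> w) \<le> t * (w \<bullet> grad l (Y t))"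
      by (simp add: Y_def)
    then show ?thesis using t by simp
  qed
  obtain r where r: "0 < r" "cball y\<^sub>1 r \<subseteq> interior domL"
    using y\<^sub>1 open_contains_cball open_interior by metis
  have "compact (l ` cball y\<^sub>1 r)"
    using r(2) interior_subset
    by (intro compact_continuous_image continuous_on_subset[OF continuous_on_l]) auto
  then have "bounded (l ` cball y\<^sub>1 r)" by (rule compact_imp_bounded)
  then obtain b where "\<And>y. y \<in> cball y\<^sub>1 r \<Longrightarrow> norm (l y) \<le> b"
    unfolding bounded_iff by blast
  then have b: "l y \<le> b" if "y \<in> cball y\<^sub>1 r" for y
    using that by force
  \<comment> \<open>One \<open>\<bar>z \<bullet> w\<bar>\<close> absorbs the term with factor
    \<open>1 - t\<close> coming from \<open>slope\<close>, the other the term with factor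
    \<open>t\<close> in the lower bound for \<open>l (Y t)\<close>.\<close>
  define c where "c = b - l y\<^sub>0 + \<bar>z \<bullet> w\<bar> + \<bar>z \<bullet> w\<bar>"
  have bound: "r * norm (grad l (Y t)) \<le> c" if t: "0 < t" "t \<le> 1" for t
  proof -
    define g where "g = grad l (Y t)"
    \<comment> \<open>The point of the ball that lies farthest in the direction \<open>g\<close>, so
      that the tangent inequality contains \<open>r * norm g\<close>.\<close>
    define y where "y = y\<^sub>1 + r *\<^sub>R sgn g"
    have y_ball: "y \<in> cball y\<^sub>1 r" using r(1) by (simp add: y_def dist_norm norm_sgn)
    have "(y - Y t) \<bullet> g \<le> l y - l (Y t)"
      unfolding g_def
      by (rule convex_on_above_gradient[OF convex_on_l GDERIV_l]) (use Y_int t r y_ball in auto)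
    moreover have "(y - Y t) \<bullet> g = (1 - t) * (w \<bullet> g) + r * norm g"
    proof -
      have "sgn g \<bullet> g = norm g"
        by (cases "g = 0") (simp_all add: sgn_div_norm power2_eq_square flip: power2_norm_eq_inner)
      moreover have "y - Y t = (1 - t) *\<^sub>R w + r *\<^sub>R sgn g"
        by (simp add: y_def Y_def w_def algebra_simps)
      ultimately show ?thesis by (simp add: inner_add_left)
    qed
    moreover have "l y \<le> b" using b[OF y_ball] .
    moreover have "(1 - t) * (z \<bullet> w) \<le> (1 - t) * (w \<bullet> g)"
      using slope[OF t] t by (intro mult_left_mono) (auto simp: g_def)
    moreover have "l y\<^sub>0 + t * (z \<bullet> w) \<le> l (Y t)"
      using max[of "Y t"] Y_int[OF t] interior_subset by (force simp: Y_def inner_add_right)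
    moreover have "- ((1 - t) * (z \<bullet> w)) \<le> \<bar>z \<bullet> w\<bar>" "- (t * (z \<bullet> w)) \<le> \<bar>z \<bullet> w\<bar>"
      using t mult_left_le_one_le[of "\<bar>z \<bullet> w\<bar>" t] mult_left_le_one_le[of "\<bar>z \<bullet> w\<bar>" "1 - t"]
        abs_ge_minus_self[of "(1 - t) * (z \<bullet> w)"] abs_ge_minus_self[of "t * (z \<bullet> w)"]
      by (auto simp: abs_mult)
    ultimately show ?thesis by (simp add: c_def g_def)
  qed
  have "filterlim (\<lambda>n. norm (grad l (Y (s n)))) at_top sequentially"
    using Y_int s by (intro grad_l_blowup[OF _ Y_tendsto[OF s0] front]) blast
  then have "\<forall>\<^sub>F n in sequentially. c / r + 1 \<le> norm (grad l (Y (s n)))"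
    unfolding filterlim_at_top by blast
  then obtain n where n: "c / r + 1 \<le> norm (grad l (Y (s n)))"
    by (meson eventually_sequentially order_refl)
  have "norm (grad l (Y (s n))) \<le> c / r"
    using bound[OF s] r(1) by (simp add: le_divide_eq mult.commute)
  with n show False by simp
qed

text \<open>Strict convexity is available on the interior of \<open>domL\<close>, where
  \<open>maximizer_interior\<close> places both points; their midpoint would then be strictly
  better.\<close>

lemma maximizer_unique:
  assumes "maximizer z y" "maximizer z y'"
  shows "y = y'"
proof (rule ccontr)
  assume "y \<noteq> y'"
  let ?m = "(1 - 1/2) *\<^sub>R y + (1/2) *\<^sub>R y'"
  have int: "y \<in> interior domL" "y' \<in> interior domL"
    using assms maximizer_interior by auto
  then have "?m \<in> interior domL"
    by (intro convexD[OF convex_interior[OF convex_dom]]) auto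
  then have "z \<bullet> ?m - l ?m \<le> z \<bullet> y - l y" "z \<bullet> ?m - l ?m \<le> z \<bullet> y' - l y'"
    using assms interior_subset unfolding maximizer_def by blast+
  moreover have "l ?m < (1 - 1/2) * l y + (1/2) * l y'"
    using int \<open>y \<noteq> y'\<close> by (intro l_strictly_convex) auto
  ultimately show False by (simp add: inner_add_right)
qed

section \<open>Differentiability of the conjugate\<close>

lemma convex_conjugate_eq:
  assumes "maximizer z y"
  shows "convex_conjugate L z = ereal (z \<bullet> y - l y)"
  unfolding convex_conjugate_def
proof (rule antisym[OF SUP_least])
  fix y' show "ereal (z \<bullet> y') - L y' \<le> ereal (z \<bullet> y - l y)"
    using assms by (cases "y' \<in> domL") (auto simp: L_eq L_eq_infinity maximizer_def)
next
  have "ereal (z \<bullet> y - l y) = ereal (z \<bullet> y) - L y"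
    using assms by (simp add: L_eq maximizer_def)
  then show "ereal (z \<bullet> y - l y) \<le> (SUP y. ereal (z \<bullet> y) - L y)"
    by (simp only:) (rule SUP_upper, simp)
qed

text \<open>On the compact set \<open>S\<close> of candidates at distance at least \<open>e\<close>
  from \<open>y\<close>, the objective for \<open>z\<close> stays below its maximum by a positive
  \<open>gap\<close>. A small change of \<open>z\<close> cannot make up for this gap.\<close>

lemma maximizer_continuous:
  assumes y: "maximizer z y" and e: "0 < e"
  shows "\<exists>\<delta>>0. \<forall>z' y'. norm (z' - z) < \<delta> \<longrightarrow> maximizer z' y' \<longrightarrow> norm (y' - y) < e"
proof -
  have yd: "y \<in> domL" using y unfolding maximizer_def by simp
  obtain r where r: "\<And>z' y'. norm (z' - z) \<le> 1 \<Longrightarrow> y' \<in> domL \<Longrightarrow>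
      z' \<bullet> y - l y \<le> z' \<bullet> y' - l y' \<Longrightarrow> norm y' \<le> r"
    using superlevel_bounded[OF yd] by metis
  have r0: "0 \<le> r" using order_trans[OF norm_ge_zero r[of z y]] yd by simp
  define S where "S = (domL \<inter> cball 0 r) - ball y e"
  have far: "y' \<in> S" if "norm (z' - z) \<le> 1" "maximizer z' y'" "\<not> norm (y' - y) < e" for z' y'
    using r[of z' y'] that yd unfolding S_def maximizer_def
    by (auto simp: dist_norm norm_minus_commute)
  show ?thesis
  proof (cases "S = {}")
    case True
    then show ?thesis using far by (intro exI[of _ 1]) force
  next
    case False
    have "compact S"
      unfolding S_def using closed_dom by (intro compact_diff) (auto simp: closed_Int_compact)
    moreover have "continuous_on S (\<lambda>y. z \<bullet> y - l y)"
      by (intro continuous_intros continuous_on_subset[OF continuous_on_l]) (auto simp: S_def)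
    ultimately obtain y\<^sub>2 where y\<^sub>2: "y\<^sub>2 \<in> S" "\<And>y'. y' \<in> S \<Longrightarrow> z \<bullet> y' - l y' \<le> z \<bullet> y\<^sub>2 - l y\<^sub>2"
      using continuous_attains_sup[OF _ False, of "\<lambda>y. z \<bullet> y - l y"] by blast
    define gap where "gap = (z \<bullet> y - l y) - (z \<bullet> y\<^sub>2 - l y\<^sub>2)"
    have "\<not> maximizer z y\<^sub>2"
      using maximizer_unique[OF y, of y\<^sub>2] y\<^sub>2(1) e by (auto simp: S_def)
    then have gap: "0 < gap"
      using y y\<^sub>2(1) unfolding gap_def maximizer_def S_def by force
    \<comment> \<open>The bound \<open>1\<close> keeps \<open>z'\<close> within the reach of
      \<open>superlevel_bounded\<close>. The denominator dominates \<open>norm (y' - y)\<close> for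
      \<open>y'\<close> in \<open>S\<close> and is positive.\<close>
    define \<delta> where "\<delta> = min 1 (gap / (r + norm y + 1))"
    have \<delta>: "0 < \<delta>" using gap r0 by (simp add: \<delta>_def add_nonneg_pos)
    have "norm (y' - y) < e" if z': "norm (z' - z) < \<delta>" and y': "maximizer z' y'" for z' y'
    proof (rule ccontr)
      assume "\<not> norm (y' - y) < e"
      then have S: "y' \<in> S" using far[of z' y'] z' y' by (simp add: \<delta>_def)
      have "z' \<bullet> y - l y \<le> z' \<bullet> y' - l y'" using y' yd unfolding maximizer_def by blast
      then have "gap \<le> (z' - z) \<bullet> (y' - y)"
        using y\<^sub>2(2)[OF S] by (simp add: gap_def algebra_simps)
      also have "\<dots> \<le> norm (z' - z) * norm (y' - y)" by (rule norm_cauchy_schwarz)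
      also have "\<dots> \<le> norm (z' - z) * (r + norm y + 1)"
        using S norm_triangle_ineq4[of y' y] by (intro mult_left_mono) (auto simp: S_def)
      also have "\<dots> < gap / (r + norm y + 1) * (r + norm y + 1)"
        using z' r0 by (intro mult_strict_right_mono) (auto simp: \<delta>_def add_nonneg_pos)
      also have "\<dots> = gap" using r0 by (simp add: add_nonneg_eq_0_iff)
      finally show False by simp
    qed
    then show ?thesis using \<delta> by blast
  qed
qed

text \<open>An envelope argument: using each maximizer as competitor in the other problem, the
  remainder of the linearisation lies between \<open>0\<close> and
  \<open>(z' - z) \<bullet> (y' - y)\<close>, and \<open>y'\<close> tends to
  \<open>y\<close>.\<close>

lemma GDERIV_conjugate:
  assumes y: "maximizer z y"
  shows "GDERIV (\<lambda>z. real_of_ereal (convex_conjugate L z)) z :> y"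
  unfolding gderiv_def has_derivative_at_alt
proof (intro conjI allI impI bounded_linear_inner_left)
  fix e :: real assume "0 < e"
  then obtain \<delta> where \<delta>: "0 < \<delta>"
    "\<And>z' y'. norm (z' - z) < \<delta> \<Longrightarrow> maximizer z' y' \<Longrightarrow> norm (y' - y) < e"
    using maximizer_continuous[OF y] by metis
  have "norm (real_of_ereal (convex_conjugate L z') - real_of_ereal (convex_conjugate L z)
      - (z' - z) \<bullet> y) \<le> e * norm (z' - z)" if z': "norm (z' - z) < \<delta>" for z'
  proof -
    obtain y' where y': "maximizer z' y'" using maximizer_exists by blast
    have 1: "z' \<bullet> y - l y \<le> z' \<bullet> y' - l y'" "z \<bullet> y' - l y' \<le> z \<bullet> y - l y"
      using y y' unfolding maximizer_def by auto
    have "(z' - z) \<bullet> (y' - y) \<le> norm (z' - z) * norm (y' - y)" by (rule norm_cauchy_schwarz)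
    also have "\<dots> \<le> norm (z' - z) * e"
      using \<delta>(2)[OF z' y'] by (intro mult_left_mono) auto
    finally have "(z' - z) \<bullet> (y' - y) \<le> e * norm (z' - z)" by (simp add: mult.commute)
    then show ?thesis
      using 1 unfolding convex_conjugate_eq[OF y] convex_conjugate_eq[OF y']
      by (simp add: algebra_simps abs_le_iff)
  qed
  then show "\<exists>d>0. \<forall>z'. norm (z' - z) < d \<longrightarrow>
      norm (real_of_ereal (convex_conjugate L z') - real_of_ereal (convex_conjugate L z)
      - (z' - z) \<bullet> y) \<le> e * norm (z' - z)"
    using \<delta>(1) by blast
qed

lemma maximizer_grad_conjugate: "maximizer z (grad (\<lambda>z. real_of_ereal (convex_conjugate L z)) z)"
proof -
  obtain y where "maximizer z y" using maximizer_exists by blast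
  then show ?thesis using grad_eqI[OF GDERIV_conjugate] by simp
qed

end

text \<open>\<open>G z\<close> is a competitor in the problem for \<open>z'\<close>. The conjugate
  is written out by Fenchel's equality, in terms whose integrability is known once \<open>z\<close>
  varies with the point.\<close>

lemma (in supercoercive_Legendre) conjugate_subgradient:
  fixes z z'
  defines "G \<equiv> grad (\<lambda>z. real_of_ereal (convex_conjugate L z))"
  shows "z \<bullet> G z - real_of_ereal (L (G z)) + G z \<bullet> (z' - z) \<le> z' \<bullet> G z' - real_of_ereal (L (G z'))"
proof -
  have "z' \<bullet> G z - l (G z) \<le> z' \<bullet> G z' - l (G z')"
    using maximizer_grad_conjugate[of z] maximizer_grad_conjugate[of z']
    unfolding G_def maximizer_def by blast
  then show ?thesis
    by (simp add: l_def inner_diff_right inner_commute)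
qed


section \<open>Lebesgue spaces\<close>

lemma L2_inner_integrable:
  assumes "f \<in> L2_space M" "g \<in> L2_space M"
  shows "integrable M (\<lambda>x. f x \<bullet> g x)"
proof (rule Bochner_Integration.integrable_bound)
  show "integrable M (\<lambda>x. (norm (f x))\<^sup>2 + (norm (g x))\<^sup>2)"
    using assms unfolding L2_space_def by auto
  show "(\<lambda>x. f x \<bullet> g x) \<in> borel_measurable M"
    using assms unfolding L2_space_def by auto
  have "\<bar>f x \<bullet> g x\<bar> \<le> (norm (f x))\<^sup>2 + (norm (g x))\<^sup>2" for x
  proof -
    have "\<bar>f x \<bullet> g x\<bar> \<le> norm (f x) * norm (g x)" by (rule Cauchy_Schwarz_ineq2)
    also have "\<dots> \<le> 2 * norm (f x) * norm (g x)" by simp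
    also have "\<dots> \<le> (norm (f x))\<^sup>2 + (norm (g x))\<^sup>2" by (rule sum_squares_bound)
    finally show ?thesis .
  qed
  then show "AE x in M. norm (f x \<bullet> g x) \<le> norm ((norm (f x))\<^sup>2 + (norm (g x))\<^sup>2)"
    by simp
qed

lemma L2_inner_commute: "L2_inner M f g = L2_inner M g f"
  unfolding L2_inner_def by (simp add: inner_commute)

lemma L2_inner_cong_AE:
  assumes "AE x in M. f x = f' x" "f \<in> borel_measurable M" "f' \<in> borel_measurable M"
    and "g \<in> borel_measurable M"
  shows "L2_inner M f g = L2_inner M f' g"
  unfolding L2_inner_def using assms by (intro integral_cong_AE) auto

lemma L2_space_measurable: "f \<in> L2_space M \<Longrightarrow> f \<in> borel_measurable M"
  unfolding L2_space_def by simp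

lemma L2_space_scale: "f \<in> L2_space M \<Longrightarrow> (\<lambda>x. c *\<^sub>R f x) \<in> L2_space M"
  unfolding L2_space_def by (auto simp: power_mult_distrib)

lemma L2_space_add:
  assumes "f \<in> L2_space M" "g \<in> L2_space M"
  shows "(\<lambda>x. f x + g x) \<in> L2_space M"
proof -
  have "integrable M (\<lambda>x. f x \<bullet> f x + 2 * (f x \<bullet> g x) + g x \<bullet> g x)"
    using assms L2_inner_integrable by (intro Bochner_Integration.integrable_add integrable_mult_right) auto
  moreover have "(norm (f x + g x))\<^sup>2 = f x \<bullet> f x + 2 * (f x \<bullet> g x) + g x \<bullet> g x" for x
    using inner_commute[of "g x" "f x"]
    by (simp add: power2_norm_eq_inner inner_add_left inner_add_right)
  ultimately have "integrable M (\<lambda>x. (norm (f x + g x))\<^sup>2)"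
    by simp
  then show ?thesis using assms unfolding L2_space_def by auto
qed

lemma L2_space_diff:
  assumes "f \<in> L2_space M" "g \<in> L2_space M"
  shows "(\<lambda>x. f x - g x) \<in> L2_space M"
  using L2_space_add[OF assms(1) L2_space_scale[OF assms(2), of "- 1"]] by simp

lemma L2_inner_add_right:
  "f \<in> L2_space M \<Longrightarrow> g \<in> L2_space M \<Longrightarrow> h \<in> L2_space M \<Longrightarrow>
    L2_inner M f (\<lambda>x. g x + h x) = L2_inner M f g + L2_inner M f h"
  unfolding L2_inner_def by (simp add: inner_add_right L2_inner_integrable)

lemma L2_inner_diff_right:
  "f \<in> L2_space M \<Longrightarrow> g \<in> L2_space M \<Longrightarrow> h \<in> L2_space M \<Longrightarrow>
    L2_inner M f (\<lambda>x. g x - h x) = L2_inner M f g - L2_inner M f h"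
  unfolding L2_inner_def by (simp add: inner_diff_right L2_inner_integrable)

lemma L2_inner_scale_right: "L2_inner M f (\<lambda>x. c *\<^sub>R g x) = c * L2_inner M f g"
  unfolding L2_inner_def by simp

lemma L2_inner_sum_right:
  assumes "f \<in> L2_space M" "\<And>i. i \<in> I \<Longrightarrow> g i \<in> L2_space M"
  shows "L2_inner M f (\<lambda>x. \<Sum>i\<in>I. c i *\<^sub>R g i x) = (\<Sum>i\<in>I. c i * L2_inner M f (g i))"
proof -
  have "(\<integral>x. f x \<bullet> (\<Sum>i\<in>I. c i *\<^sub>R g i x) \<partial>M) = (\<integral>x. (\<Sum>i\<in>I. c i * (f x \<bullet> g i x)) \<partial>M)"
    by (simp add: inner_sum_right)
  also have "\<dots> = (\<Sum>i\<in>I. (\<integral>x. c i * (f x \<bullet> g i x) \<partial>M))"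
    using assms by (intro Bochner_Integration.integral_sum integrable_mult_right L2_inner_integrable)
  finally show ?thesis unfolding L2_inner_def by simp
qed

lemma L2_norm_nonneg: "0 \<le> L2_norm M f"
  unfolding L2_norm_def L2_inner_def by simp

lemma L2_norm_power2: "(L2_norm M f)\<^sup>2 = L2_inner M f f"
  unfolding L2_norm_def L2_inner_def by simp

text \<open>The degenerate case of the Cauchy-Schwarz inequality: a function of seminorm
  \<open>0\<close> vanishes almost everywhere.\<close>

lemma L2_inner_eq_0_if_norm_eq_0:
  assumes "f \<in> L2_space M" "g \<in> L2_space M" "L2_norm M g = 0"
  shows "L2_inner M f g = 0"
proof -
  have "(\<integral>x. g x \<bullet> g x \<partial>M) = 0"
    using L2_norm_power2[of M g] assms(3) unfolding L2_inner_def by simp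
  then have "AE x in M. g x \<bullet> g x = 0"
    using integral_nonneg_eq_0_iff_AE[OF L2_inner_integrable[OF assms(2,2)]] by simp
  then have "AE x in M. f x \<bullet> g x = 0" by eventually_elim simp
  then show ?thesis
    unfolding L2_inner_def by (rule integral_eq_zero_AE)
qed

lemma L2_Cauchy_Schwarz:
  assumes "f \<in> L2_space M" "g \<in> L2_space M"
  shows "L2_inner M f g \<le> L2_norm M f * L2_norm M g"
proof (cases "L2_norm M f = 0 \<or> L2_norm M g = 0")
  case True
  then have "L2_inner M f g = 0"
    using L2_inner_eq_0_if_norm_eq_0[OF assms] L2_inner_eq_0_if_norm_eq_0[OF assms(2,1)]
      L2_inner_commute[of M f g] by auto
  with True show ?thesis by auto
next
  case False
  let ?s = "L2_norm M f" and ?r = "L2_norm M g"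
  have pos: "0 < ?s * ?r" using False L2_norm_nonneg[of M f] L2_norm_nonneg[of M g] by simp
  \<comment> \<open>The squared norm of this combination is
    \<open>2 * (?s * ?r) * (?s * ?r - L2_inner M f g)\<close>, whose first factors are
    positive.\<close>
  define k where "k x = ?r *\<^sub>R f x - ?s *\<^sub>R g x" for x
  have sp: "(\<lambda>x. ?r *\<^sub>R f x) \<in> L2_space M" "(\<lambda>x. ?s *\<^sub>R g x) \<in> L2_space M"
    using assms L2_space_scale by auto
  then have k: "k \<in> L2_space M" unfolding k_def[abs_def] by (rule L2_space_diff)
  have kf: "L2_inner M k f = ?r * ?s\<^sup>2 - ?s * L2_inner M f g"
    using L2_inner_diff_right[OF assms(1) sp]
    by (subst L2_inner_commute) (simp add: k_def[abs_def] L2_inner_scale_right L2_norm_power2)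
  have kg: "L2_inner M k g = ?r * L2_inner M f g - ?s * ?r\<^sup>2"
    using L2_inner_diff_right[OF assms(2) sp] L2_inner_commute[of M f g]
    by (subst L2_inner_commute) (simp add: k_def[abs_def] L2_inner_scale_right L2_norm_power2)
  have "0 \<le> (L2_norm M k)\<^sup>2" by simp
  also have "\<dots> = L2_inner M k (\<lambda>x. ?r *\<^sub>R f x - ?s *\<^sub>R g x)"
    by (simp add: L2_norm_power2 k_def[abs_def])
  also have "\<dots> = ?r * L2_inner M k f - ?s * L2_inner M k g"
    by (simp add: L2_inner_diff_right[OF k sp] L2_inner_scale_right)
  also have "\<dots> = 2 * (?s * ?r) * (?s * ?r - L2_inner M f g)"
    unfolding kf kg by (simp add: algebra_simps power2_eq_square)
  finally show ?thesis using pos by (simp add: zero_le_mult_iff)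
qed

section \<open>Essentially bounded functions\<close>

lemma Linf_space_measurable: "f \<in> Linf_space M \<Longrightarrow> f \<in> borel_measurable M"
  unfolding Linf_space_def by simp

lemma Linf_space_bounded:
  assumes "f \<in> Linf_space M"
  obtains c where "0 \<le> c" "AE x in M. norm (f x) \<le> c"
proof -
  let ?s = "esssup M (\<lambda>x. ereal (norm (f x)))"
  have le: "?s \<le> ereal (max 0 (real_of_ereal ?s))"
    using assms unfolding Linf_space_def by (cases ?s) auto
  have "AE x in M. ereal (norm (f x)) \<le> ?s" by (rule esssup_AE)
  then have "AE x in M. norm (f x) \<le> max 0 (real_of_ereal ?s)"
  proof eventually_elim
    case (elim x)
    then have "ereal (norm (f x)) \<le> ereal (max 0 (real_of_ereal ?s))"
      using le by (rule order_trans)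
    then show ?case by (simp only: ereal_less_eq)
  qed
  then show thesis using that[of "max 0 (real_of_ereal ?s)"] by simp
qed

lemma Linf_spaceI:
  assumes "f \<in> borel_measurable M" "AE x in M. norm (f x) \<le> c"
  shows "f \<in> Linf_space M"
proof -
  have "esssup M (\<lambda>x. ereal (norm (f x))) \<le> ereal c"
    using assms by (intro esssup_I) auto
  also have "\<dots> < \<infinity>" by simp
  finally show ?thesis unfolding Linf_space_def using assms(1) by simp
qed

text \<open>The condition \<open>0 \<le> c\<close> covers the null measure: there the essential
  supremum is \<open>-\<infinity>\<close>, and its conversion to a real number is
  \<open>0\<close>.\<close>

lemma Linf_norm_le:
  assumes "f \<in> borel_measurable M" "AE x in M. norm (f x) \<le> c" "0 \<le> c"
  shows "Linf_norm M f \<le> c"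
proof -
  have "esssup M (\<lambda>x. ereal (norm (f x))) \<le> ereal c"
    using assms by (intro esssup_I) auto
  then show ?thesis
    unfolding Linf_norm_def using assms(3)
    by (cases "esssup M (\<lambda>x. ereal (norm (f x)))") auto
qed

lemma Linf_space_add:
  assumes "f \<in> Linf_space M" "g \<in> Linf_space M"
  shows "(\<lambda>x. f x + g x) \<in> Linf_space M"
proof -
  obtain c d where "AE x in M. norm (f x) \<le> c" "AE x in M. norm (g x) \<le> d"
    using Linf_space_bounded assms by metis
  then have "AE x in M. norm (f x + g x) \<le> c + d"
    by eventually_elim (rule norm_triangle_mono)
  then show ?thesis
    using assms[THEN Linf_space_measurable] by (intro Linf_spaceI) auto
qed

lemma Linf_space_scale:
  assumes "f \<in> Linf_space M"
  shows "(\<lambda>x. k *\<^sub>R f x) \<in> Linf_space M"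
proof -
  obtain c where "AE x in M. norm (f x) \<le> c"
    using Linf_space_bounded assms by metis
  then have "AE x in M. norm (k *\<^sub>R f x) \<le> \<bar>k\<bar> * c"
    by eventually_elim (simp add: mult_left_mono)
  then show ?thesis
    using assms[THEN Linf_space_measurable] by (intro Linf_spaceI) auto
qed

lemma (in finite_measure) Linf_space_subset_L2_space: "Linf_space M \<subseteq> L2_space M"
proof
  fix f :: "'a \<Rightarrow> 'b::euclidean_space" assume f: "f \<in> Linf_space M"
  then obtain c where "0 \<le> c" "AE x in M. norm (f x) \<le> c" by (rule Linf_space_bounded)
  from this(2) have "AE x in M. norm ((norm (f x))\<^sup>2) \<le> c\<^sup>2"
    by eventually_elim (simp add: power_mono)
  then have "integrable M (\<lambda>x. (norm (f x))\<^sup>2)"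
    using Linf_space_measurable[OF f] by (intro integrable_const_bound) auto
  then show "f \<in> L2_space M"
    unfolding L2_space_def using Linf_space_measurable[OF f] by simp
qed

text \<open>Supplies the ray continuity asked for by \<open>strongly_convex_critical_point\<close>.
  The ray is Lipschitz in the essential supremum norm, \<open>T\<close> carries this to
  \<open>L2_norm\<close>, and Cauchy-Schwarz handles the pairing with \<open>v\<close>.\<close>

lemma L2_inner_ray_continuous:
  assumes cont: "continuous_wrt_norms (Linf_norm M) (L2_norm M) (Linf_space M) T"
    and T: "\<And>w. w \<in> Linf_space M \<Longrightarrow> T w \<in> L2_space M"
    and w: "w \<in> Linf_space M" and v: "v \<in> Linf_space M" "v \<in> L2_space M"
  shows "((\<lambda>t. L2_inner M (T (\<lambda>s. w s + t *\<^sub>R v s)) v) \<longlongrightarrow> L2_inner M (T w) v) (at_right 0)"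
proof (rule tendstoI)
  fix e :: real assume e: "0 < e"
  \<comment> \<open>Adding \<open>1\<close> keeps the divisor positive when \<open>v\<close>
    vanishes and makes the final estimate strict.\<close>
  define n where "n = L2_norm M v + 1"
  have n: "0 < n" unfolding n_def using L2_norm_nonneg[of M v] by simp
  obtain \<delta> where \<delta>: "0 < \<delta>" "\<And>g. g \<in> Linf_space M \<Longrightarrow> Linf_norm M (\<lambda>x. g x - w x) < \<delta> \<Longrightarrow>
      L2_norm M (\<lambda>x. T g x - T w x) < e / n"
    using cont w divide_pos_pos[OF e n] unfolding continuous_wrt_norms_def by blast
  obtain c where c: "0 \<le> c" "AE x in M. norm (v x) \<le> c"
    using Linf_space_bounded[OF v(1)] .
  show "\<forall>\<^sub>F t in at_right 0. dist (L2_inner M (T (\<lambda>s. w s + t *\<^sub>R v s)) v) (L2_inner M (T w) v) < e"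
    unfolding eventually_at_right_field
  proof (intro exI[of _ "\<delta> / (c + 1)"] conjI allI impI)
    show "0 < \<delta> / (c + 1)" using \<delta>(1) c(1) by simp
  next
    fix t :: real assume t: "0 < t" "t < \<delta> / (c + 1)"
    let ?g = "\<lambda>s. w s + t *\<^sub>R v s"
    have g: "?g \<in> Linf_space M" using w v(1) by (intro Linf_space_add Linf_space_scale)
    have "AE x in M. norm (t *\<^sub>R v x) \<le> t * c"
      using c(2) by eventually_elim (use t in simp)
    then have "Linf_norm M (\<lambda>x. t *\<^sub>R v x) \<le> t * c"
      using t c(1) Linf_space_measurable[OF v(1)] by (intro Linf_norm_le) auto
    also have "\<dots> < \<delta>"
      using t c(1) by (simp add: less_divide_eq algebra_simps)
    finally have small: "L2_norm M (\<lambda>x. T ?g x - T w x) < e / n"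
      using \<delta>(2)[OF g] by simp
    have d: "(\<lambda>x. T ?g x - T w x) \<in> L2_space M"
      using T g w by (intro L2_space_diff) auto
    have eq: "L2_inner M (\<lambda>x. T ?g x - T w x) v = L2_inner M (T ?g) v - L2_inner M (T w) v"
      using L2_inner_diff_right[OF v(2) T[OF g] T[OF w]] by (simp add: L2_inner_commute[of M _ v])
    have minus: "L2_inner M (\<lambda>x. T ?g x - T w x) (\<lambda>x. - v x) = - L2_inner M (\<lambda>x. T ?g x - T w x) v"
      "L2_norm M (\<lambda>x. - v x) = L2_norm M v" "(\<lambda>x. - v x) \<in> L2_space M"
      using L2_space_scale[OF v(2), of "- 1"] by (auto simp: L2_inner_def L2_norm_def)
    have "\<bar>L2_inner M (\<lambda>x. T ?g x - T w x) v\<bar> \<le> L2_norm M (\<lambda>x. T ?g x - T w x) * L2_norm M v"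
      using L2_Cauchy_Schwarz[OF d v(2)] L2_Cauchy_Schwarz[OF d minus(3)] minus by simp
    also have "\<dots> \<le> e / n * L2_norm M v"
      using small by (intro mult_right_mono L2_norm_nonneg) simp
    also have "\<dots> < e"
      using e n by (simp add: n_def divide_less_eq)
    finally show "dist (L2_inner M (T ?g) v) (L2_inner M (T w) v) < e"
      by (simp add: eq dist_real_def)
  qed
qed

lemma fin_dim_Linf_subspace_closed:
  assumes "fin_dim_Linf_subspace M S"
  shows "S \<subseteq> Linf_space M" "(\<lambda>_. 0) \<in> S"
    and "\<And>w w'. w \<in> S \<Longrightarrow> w' \<in> S \<Longrightarrow> (\<lambda>x. w x + w' x) \<in> S"
    and "\<And>k w. w \<in> S \<Longrightarrow> (\<lambda>x. k *\<^sub>R w x) \<in> S"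
proof -
  obtain G where S: "S = {w \<in> Linf_space M. \<exists>c. AE x in M. w x = (\<Sum>g\<in>G. c g *\<^sub>R g x)}"
    using assms unfolding fin_dim_Linf_subspace_def by blast
  show "S \<subseteq> Linf_space M" unfolding S by blast
  have "(\<lambda>_. 0) \<in> Linf_space M" by (rule Linf_spaceI[where c = 0]) auto
  moreover have "AE x in M. 0 = (\<Sum>g\<in>G. 0 *\<^sub>R g x)" by simp
  ultimately show "(\<lambda>_. 0) \<in> S"
    unfolding S mem_Collect_eq by (intro conjI exI[of _ "\<lambda>_. 0"])
  show "(\<lambda>x. w x + w' x) \<in> S" if ww': "w \<in> S" "w' \<in> S" for w w'
  proof -
    obtain c c' where "AE x in M. w x = (\<Sum>g\<in>G. c g *\<^sub>R g x)" "AE x in M. w' x = (\<Sum>g\<in>G. c' g *\<^sub>R g x)"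
      using ww' unfolding S by blast
    then have "AE x in M. w x + w' x = (\<Sum>g\<in>G. (c g + c' g) *\<^sub>R g x)"
      by eventually_elim (simp add: scaleR_add_left sum.distrib)
    moreover have "(\<lambda>x. w x + w' x) \<in> Linf_space M"
      using ww' unfolding S by (intro Linf_space_add) auto
    ultimately show ?thesis
      unfolding S mem_Collect_eq by (intro conjI exI[of _ "\<lambda>g. c g + c' g"])
  qed
  show "(\<lambda>x. k *\<^sub>R w x) \<in> S" if w: "w \<in> S" for k w
  proof -
    obtain c where "AE x in M. w x = (\<Sum>g\<in>G. c g *\<^sub>R g x)"
      using w unfolding S by blast
    then have "AE x in M. k *\<^sub>R w x = (\<Sum>g\<in>G. (k * c g) *\<^sub>R g x)"
      by eventually_elim (simp add: scaleR_sum_right)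
    moreover have "(\<lambda>x. k *\<^sub>R w x) \<in> Linf_space M"
      using w unfolding S by (intro Linf_space_scale) auto
    ultimately show ?thesis
      unfolding S mem_Collect_eq by (intro conjI exI[of _ "\<lambda>g. k * c g"])
  qed
qed


section \<open>The discrete saddle point problem\<close>

text \<open>\<open>T\<close> stands for \<open>grad_conjugate R\<close> and \<open>potential\<close>
  for the integral of the conjugate; convex analysis enters only as a subgradient inequality. The
  inf-sup condition enters as injectivity: an element of \<open>Wh\<close> that annihilates
  \<open>Vh\<close> is zero.\<close>

locale discrete_saddle_point = finite_measure M for M :: "'a measure" +
  fixes \<iota> :: "'q::real_normed_vector \<Rightarrow> 'a \<Rightarrow> 'b::euclidean_space"
    and B :: "'v::{real_inner, complete_space} \<Rightarrow> 'q"
    and a :: "'v \<Rightarrow> 'v \<Rightarrow> real" and \<nu> M\<^sub>a :: real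
    and T :: "('a \<Rightarrow> 'b) \<Rightarrow> ('a \<Rightarrow> 'b)" and potential :: "('a \<Rightarrow> 'b) \<Rightarrow> real"
    and Vh :: "'v set" and Wh :: "('a \<Rightarrow> 'b) set"
  assumes \<iota>: "dense_L2_embedding M \<iota>"
    and B: "bounded_linear B"
    and a: "bilinear a" "\<And>u v. a u v = a v u"
      "0 < \<nu>" "\<And>u. \<nu> * (norm u)\<^sup>2 \<le> a u u" "\<And>u v. a u v \<le> M\<^sub>a * norm u * norm v"
    and T: "\<And>w. w \<in> Linf_space M \<Longrightarrow> T w \<in> L2_space M"
      "continuous_wrt_norms (Linf_norm M) (L2_norm M) (Linf_space M) T"
    and potential: "\<And>w w'. w \<in> Linf_space M \<Longrightarrow> w' \<in> Linf_space M \<Longrightarrow>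
      potential w + L2_inner M (T w) (\<lambda>x. w' x - w x) \<le> potential w'"
    and Vh: "fin_dim_subspace Vh"
    and Wh: "Wh \<subseteq> Linf_space M" "(\<lambda>_. 0) \<in> Wh"
      "\<And>w w'. w \<in> Wh \<Longrightarrow> w' \<in> Wh \<Longrightarrow> (\<lambda>x. w x + w' x) \<in> Wh"
      "\<And>c w. w \<in> Wh \<Longrightarrow> (\<lambda>x. c *\<^sub>R w x) \<in> Wh"
    and inf_sup: "\<And>w. w \<in> Wh \<Longrightarrow> (\<And>v. v \<in> Vh \<Longrightarrow> coupling_form M \<iota> B v w = 0) \<Longrightarrow>
      AE x in M. w x = 0"
begin

section \<open>The discrete spaces and the forms \<open>a\<close> and \<open>b\<close>\<close>

abbreviation "b \<equiv> coupling_form M \<iota> B"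

lemma Linf_L2: "w \<in> Linf_space M \<Longrightarrow> w \<in> L2_space M" for w :: "'a \<Rightarrow> 'b"
  using Linf_space_subset_L2_space by blast

lemma Wh_L2: "w \<in> Wh \<Longrightarrow> w \<in> L2_space M"
  using Wh(1) Linf_L2 by blast

lemma Wh_diff: "w \<in> Wh \<Longrightarrow> w' \<in> Wh \<Longrightarrow> (\<lambda>x. w x - w' x) \<in> Wh"
  using Wh(3)[OF _ Wh(4)[of w' "- 1"], of w] by simp

lemma Wh_sum:
  assumes "finite I" "\<And>i. i \<in> I \<Longrightarrow> w i \<in> Wh"
  shows "(\<lambda>x. \<Sum>i\<in>I. c i *\<^sub>R w i x) \<in> Wh"
  using assms by (induction I rule: finite_induct) (auto intro!: Wh)

lemma \<iota>_L2: "\<iota> q \<in> L2_space M"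
  using \<iota> unfolding dense_L2_embedding_def by (elim conjE) (rule spec)

lemma subspace_Vh: "subspace Vh"
  using Vh unfolding fin_dim_subspace_def by auto

lemma closed_Vh: "closed Vh"
  using Vh closed_span_finite_real_inner unfolding fin_dim_subspace_def by auto

lemma b_diff: "w \<in> L2_space M \<Longrightarrow> w' \<in> L2_space M \<Longrightarrow> b v (\<lambda>x. w x - w' x) = b v w - b v w'"
  unfolding coupling_form_def by (rule L2_inner_diff_right[OF \<iota>_L2])

text \<open>\<open>\<iota>\<close> is linear only up to null sets, which the integral does not see.
  The bound combines Cauchy-Schwarz with the continuity of \<open>\<iota>\<close> and
  \<open>B\<close>.\<close>

lemma bounded_linear_b:
  assumes w: "w \<in> L2_space M"
  shows "bounded_linear (\<lambda>v. b v w)"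
proof -
  have "\<exists>c. \<forall>q. L2_norm M (\<iota> q) \<le> c * norm q"
    using \<iota> unfolding dense_L2_embedding_def by (elim conjE)
  then obtain c where c: "\<And>q. L2_norm M (\<iota> q) \<le> c * norm q" by blast
  obtain k where k: "\<And>v. norm (B v) \<le> norm v * k" "0 \<le> k"
    using bounded_linear.nonneg_bounded[OF B] by blast
  have meas: "w \<in> borel_measurable M" "\<And>q. \<iota> q \<in> borel_measurable M"
    by (rule L2_space_measurable, rule w) (rule L2_space_measurable[OF \<iota>_L2])
  have add: "b (u + v) w = b u w + b v w" for u v
  proof -
    have "AE x in M. \<iota> (B (u + v)) x = \<iota> (B u) x + \<iota> (B v) x"
      unfolding linear_add[OF bounded_linear.linear[OF B]]
      using \<iota> unfolding dense_L2_embedding_def by (elim conjE) (simp only: HOL.simp_thms)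
    then have "L2_inner M (\<iota> (B (u + v))) w = L2_inner M (\<lambda>x. \<iota> (B u) x + \<iota> (B v) x) w"
      using meas by (intro L2_inner_cong_AE) auto
    then show ?thesis
      unfolding coupling_form_def L2_inner_commute[of M _ w]
      by (simp add: L2_inner_add_right[OF w] \<iota>_L2)
  qed
  have scale: "b (r *\<^sub>R v) w = r *\<^sub>R b v w" for r v
  proof -
    have "AE x in M. \<iota> (B (r *\<^sub>R v)) x = r *\<^sub>R \<iota> (B v) x"
      unfolding linear_scale[OF bounded_linear.linear[OF B]]
      using \<iota> unfolding dense_L2_embedding_def by (elim conjE) (simp only: HOL.simp_thms)
    then have "L2_inner M (\<iota> (B (r *\<^sub>R v))) w = L2_inner M (\<lambda>x. r *\<^sub>R \<iota> (B v) x) w"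
      using meas by (intro L2_inner_cong_AE) auto
    then show ?thesis
      unfolding coupling_form_def L2_inner_commute[of M _ w]
      by (simp add: L2_inner_scale_right)
  qed
  have le: "b v w \<le> norm v * (\<bar>c\<bar> * k * L2_norm M w)" for v
  proof -
    have "b v w \<le> L2_norm M (\<iota> (B v)) * L2_norm M w"
      unfolding coupling_form_def by (rule L2_Cauchy_Schwarz[OF \<iota>_L2 w])
    \<comment> \<open>The embedding constant \<open>c\<close> may be negative, hence the absolute
      value.\<close>
    also have "\<dots> \<le> \<bar>c\<bar> * (norm v * k) * L2_norm M w"
    proof (rule mult_right_mono[OF order_trans[OF c] L2_norm_nonneg])
      have "c * norm (B v) \<le> \<bar>c\<bar> * norm (B v)" by (simp add: mult_right_mono)
      also have "\<dots> \<le> \<bar>c\<bar> * (norm v * k)" using k by (intro mult_left_mono) auto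
      finally show "c * norm (B v) \<le> \<bar>c\<bar> * (norm v * k)" .
    qed
    finally show ?thesis by (simp add: algebra_simps)
  qed
  show ?thesis
  proof (rule bounded_linear_intro[OF add scale])
    fix v
    show "norm (b v w) \<le> norm v * (\<bar>c\<bar> * k * L2_norm M w)"
      using le[of v] le[of "- v"] scale[of "- 1" v] by (simp add: abs_le_iff)
  qed
qed

lemma bounded_linear_a: "bounded_linear (a u)"
proof -
  have lin: "linear (a u)" using a(1) unfolding bilinear_def by blast
  show ?thesis
  proof (rule bounded_linear_intro)
    fix v
    show "norm (a u v) \<le> norm v * (M\<^sub>a * norm u)"
      using a(5)[of u v] a(5)[of u "- v"] linear_neg[OF lin, of v]
      by (simp add: abs_le_iff algebra_simps)
  qed (use lin in \<open>auto simp: linear_add linear_scale\<close>)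
qed

lemmas a_linear = bilinear_ladd[OF a(1)] bilinear_radd[OF a(1)] bilinear_lmul[OF a(1)]
  bilinear_rmul[OF a(1)] bilinear_lsub[OF a(1)] bilinear_rsub[OF a(1)]

lemma a_expand: "a (y - x) (y - x) = a y y - 2 * a x y + a x x"
  using a(2)[of y x] by (simp add: a_linear)

text \<open>The equation is the critical point equation of the energy \<open>a u u / 2 - f u\<close>
  on \<open>Vh\<close>, and coercivity of \<open>a\<close> makes this energy strongly convex with
  constant \<nu>/2.\<close>

lemma discrete_Riesz:
  assumes f: "bounded_linear f"
  shows "\<exists>u\<in>Vh. \<forall>v\<in>Vh. a u v = f v"
proof -
  interpret f: bounded_linear f by (rule f)
  have "\<exists>u\<in>Vh. \<forall>v\<in>Vh. a u v - f v = 0"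
  proof (rule strongly_convex_critical_point[OF subspace_Vh closed_Vh,
        where J = "\<lambda>u. a u u / 2 - f u" and \<kappa> = "\<nu> / 2"])
    show "bounded_linear (\<lambda>v. a x v - f v)" for x
      by (intro bounded_linear_sub bounded_linear_a f)
  next
    fix x y
    show "a x x / 2 - f x + (a x (y - x) - f (y - x)) + \<nu> / 2 * (norm (y - x))\<^sup>2 \<le> a y y / 2 - f y"
      using a(4)[of "y - x"] a_expand[of y x] by (simp add: a_linear f.diff field_simps)
  next
    fix x h
    show "((\<lambda>t. a (x + t *\<^sub>R h) h - f h) \<longlongrightarrow> a x h - f h) (at_right 0)"
      by (auto simp: a_linear intro!: tendsto_eq_intros)
  qed (use a(3) in simp)
  then show ?thesis by simp
qed

section \<open>Representing latent variables by primal vectors\<close>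

definition "lifts x w \<longleftrightarrow> x \<in> Vh \<and> w \<in> Wh \<and> (\<forall>v\<in>Vh. a x v = b v w)"

definition "X = {x. \<exists>w. lifts x w}"

lemma lifts_exists: "w \<in> Wh \<Longrightarrow> \<exists>x. lifts x w"
  using discrete_Riesz[OF bounded_linear_b[OF Wh_L2]] unfolding lifts_def by blast

text \<open>The difference annihilates \<open>Vh\<close>, so the inf-sup condition applies. Hence
  \<open>X\<close> parametrises \<open>Wh\<close> up to equality almost everywhere.\<close>

lemma lifts_unique:
  assumes "lifts x w" "lifts x w'"
  shows "AE s in M. w s = w' s"
proof -
  have "AE s in M. w s - w' s = 0"
  proof (rule inf_sup)
    show "(\<lambda>s. w s - w' s) \<in> Wh" using assms Wh_diff unfolding lifts_def by blast
    show "b v (\<lambda>s. w s - w' s) = 0" if "v \<in> Vh" for v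
      using assms that Wh_L2 by (auto simp: lifts_def b_diff)
  qed
  then show ?thesis by simp
qed

lemma lifts_sum:
  assumes "finite I" "\<And>i. i \<in> I \<Longrightarrow> lifts (x i) (w i)"
  shows "lifts (\<Sum>i\<in>I. c i *\<^sub>R x i) (\<lambda>s. \<Sum>i\<in>I. c i *\<^sub>R w i s)"
proof -
  have "a (\<Sum>i\<in>I. c i *\<^sub>R x i) v = b v (\<lambda>s. \<Sum>i\<in>I. c i *\<^sub>R w i s)" if v: "v \<in> Vh" for v
  proof -
    have "a (\<Sum>i\<in>I. c i *\<^sub>R x i) v = (\<Sum>i\<in>I. c i * a v (x i))"
      by (simp add: a(2)[of _ v] linear_sum[OF bounded_linear.linear[OF bounded_linear_a]] a_linear)
    also have "\<dots> = (\<Sum>i\<in>I. c i * b v (w i))"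
      using assms(2) v by (intro sum.cong) (auto simp: lifts_def a(2)[of v])
    also have "\<dots> = b v (\<lambda>s. \<Sum>i\<in>I. c i *\<^sub>R w i s)"
      unfolding coupling_form_def using assms(2) Wh_L2
      by (intro L2_inner_sum_right[symmetric] \<iota>_L2) (auto simp: lifts_def)
    finally show ?thesis .
  qed
  moreover have "(\<Sum>i\<in>I. c i *\<^sub>R x i) \<in> Vh"
    using assms(2) subspace_Vh by (intro subspace_sum subspace_scale) (auto simp: lifts_def)
  moreover have "(\<lambda>s. \<Sum>i\<in>I. c i *\<^sub>R w i s) \<in> Wh"
    using assms by (intro Wh_sum) (auto simp: lifts_def)
  ultimately show ?thesis unfolding lifts_def by blast
qed

lemma subspace_X: "subspace X"
proof (rule subspaceI)
  show "0 \<in> X"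
    using lifts_sum[of "{} :: nat set" "\<lambda>_. 0" "\<lambda>_ _. 0" "\<lambda>_. 0"] unfolding X_def by auto
next
  fix x y assume "x \<in> X" "y \<in> X"
  then obtain w w' where "lifts x w" "lifts y w'" unfolding X_def by blast
  \<comment> \<open>A sum over the two truth values presents \<open>x + y\<close> as an instance of
    \<open>lifts_sum\<close>.\<close>
  then have "lifts (\<Sum>i\<in>{True, False}. 1 *\<^sub>R (if i then x else y))
      (\<lambda>s. \<Sum>i\<in>{True, False}. 1 *\<^sub>R (if i then w else w') s)"
    by (intro lifts_sum) auto
  then show "x + y \<in> X" unfolding X_def by auto
next
  fix c x assume "x \<in> X"
  then obtain w where "lifts x w" unfolding X_def by blast
  then show "c *\<^sub>R x \<in> X"
    using lifts_sum[of "{True}" "\<lambda>_. x" "\<lambda>_. w" "\<lambda>_. c"] unfolding X_def by auto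
qed

text \<open>\<open>X\<close> lies in \<open>Vh\<close>, so independent subsets of it are finite, and
  Gram-Schmidt applies to a basis.\<close>

lemma X_orthogonal_basis:
  obtains C where "finite C" "pairwise orthogonal C" "span C = X"
proof -
  obtain G where G: "finite G" "Vh = span G" using Vh unfolding fin_dim_subspace_def by blast
  obtain E where E: "E \<subseteq> X" "independent E" "X \<subseteq> span E" by (rule basis_exists)
  have "E \<subseteq> span G" using E(1) G(2) unfolding X_def lifts_def by blast
  then have "finite E" using independent_span_bound[OF G(1) E(2)] by blast
  then obtain C where "finite C" "span C = span E" "pairwise orthogonal C"
    using basis_orthogonal by blast
  moreover have "span E = X"
    using E(1,3) span_minimal[OF E(1) subspace_X] by blast
  ultimately show thesis using that by blast
qed

lemma closed_X: "closed X"
proof -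
  obtain C where "finite C" "span C = X" by (rule X_orthogonal_basis)
  then show ?thesis using closed_span_finite_real_inner[of C] by simp
qed

section \<open>The dual problem on the space \<open>X\<close>\<close>

lemma dual_problem_solvable:
  assumes \<alpha>: "0 < \<alpha>"
  shows "\<exists>x \<psi>. lifts x \<psi> \<and> (\<forall>h w. lifts h w \<longrightarrow> L2_inner M (T \<psi>) w + a x h / \<alpha> - a p h = 0)"
proof -
  obtain C where C: "finite C" "pairwise orthogonal C" "span C = X"
    by (rule X_orthogonal_basis)
  have "\<forall>e\<in>C. \<exists>w. lifts e w"
    using span_superset[of C] unfolding C(3) unfolding X_def by blast
  then obtain g where g: "\<And>e. e \<in> C \<Longrightarrow> lifts e (g e)" by metis
  \<comment> \<open>One fixed representative for each spanning vector makes \<open>\<psi> x\<close>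
    linear in \<open>x\<close> at every point, and not just almost everywhere.\<close>
  define \<psi> where "\<psi> x s = (\<Sum>e\<in>C. (x \<bullet> e / (e \<bullet> e)) *\<^sub>R g e s)" for x s
  have lifts_\<psi>: "lifts x (\<psi> x)" if "x \<in> X" for x
    using lifts_sum[OF C(1) g, of "\<lambda>e. e" "\<lambda>e. x \<bullet> e / (e \<bullet> e)"]
      orthogonal_expansion[OF C(1,2), of x] that C(3) by (simp add: \<psi>_def[abs_def])
  have g_Linf: "g e \<in> Linf_space M" if "e \<in> C" for e
    using g[OF that] Wh(1) unfolding lifts_def by blast
  have \<psi>_Linf: "\<psi> x \<in> Linf_space M" if "x \<in> X" for x
    using lifts_\<psi>[OF that] Wh(1) unfolding lifts_def by blast
  have \<psi>_diff: "\<psi> (y - x) s = \<psi> y s - \<psi> x s" for x y s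
    unfolding \<psi>_def by (simp add: inner_diff_left diff_divide_distrib scaleR_diff_left sum_subtractf)
  have \<psi>_ray: "\<psi> (x + t *\<^sub>R h) = (\<lambda>s. \<psi> x s + t *\<^sub>R \<psi> h s)" for x h t
    unfolding \<psi>_def
    by (simp add: inner_add_left add_divide_distrib scaleR_add_left sum.distrib scaleR_sum_right)
  define D where "D x h = L2_inner M (T (\<psi> x)) (\<psi> h) + a x h / \<alpha> - a p h" for x h
  define J where "J x = potential (\<psi> x) + a x x / (2 * \<alpha>) - a p x" for x
  have "\<exists>x\<in>X. \<forall>h\<in>X. D x h = 0"
  proof (rule strongly_convex_critical_point[OF subspace_X closed_X,
        where J = J and \<kappa> = "\<nu> / (2 * \<alpha>)"])
    show "0 < \<nu> / (2 * \<alpha>)" using a(3) \<alpha> by simp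
  next
    fix x assume x: "x \<in> X"
    \<comment> \<open>Through the coordinates in \<open>C\<close> the nonlinear term is a finite
      combination of continuous functionals of \<open>h\<close>.\<close>
    have "L2_inner M (T (\<psi> x)) (\<psi> h) = (\<Sum>e\<in>C. (h \<bullet> e / (e \<bullet> e)) * L2_inner M (T (\<psi> x)) (g e))" for h
      unfolding \<psi>_def[of h, abs_def]
      by (rule L2_inner_sum_right) (use T \<psi>_Linf x g_Linf Linf_L2 in auto)
    moreover have "bounded_linear (\<lambda>h. \<Sum>e\<in>C. (h \<bullet> e / (e \<bullet> e)) * L2_inner M (T (\<psi> x)) (g e))"
      unfolding divide_inverse
      by (intro bounded_linear_sum bounded_linear_mult_const bounded_linear_inner_left)
    ultimately show "bounded_linear (D x)"
      unfolding D_def[abs_def] divide_inverse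
      by (intro bounded_linear_sub bounded_linear_add bounded_linear_mult_const bounded_linear_a) simp
  next
    fix x y assume xy: "x \<in> X" "y \<in> X"
    have "potential (\<psi> x) + L2_inner M (T (\<psi> x)) (\<psi> (y - x)) \<le> potential (\<psi> y)"
      using potential[OF \<psi>_Linf[OF xy(1)] \<psi>_Linf[OF xy(2)]] by (simp add: \<psi>_diff[abs_def])
    \<comment> \<open>The quadratic gain comes from the coercivity of \<open>a\<close> alone;
      \<open>potential\<close> contributes a plain subgradient inequality.\<close>
    moreover have "a x x / (2 * \<alpha>) + a x (y - x) / \<alpha> + \<nu> / (2 * \<alpha>) * (norm (y - x))\<^sup>2 \<le> a y y / (2 * \<alpha>)"
    proof -
      have "a x x + 2 * a x (y - x) + \<nu> * (norm (y - x))\<^sup>2 \<le> a y y"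
        using a(4)[of "y - x"] a_expand[of y x] by (simp add: a_linear)
      then have "(a x x + 2 * a x (y - x) + \<nu> * (norm (y - x))\<^sup>2) / (2 * \<alpha>) \<le> a y y / (2 * \<alpha>)"
        using \<alpha> by (intro divide_right_mono) auto
      then show ?thesis by (simp add: add_divide_distrib)
    qed
    ultimately show "J x + D x (y - x) + \<nu> / (2 * \<alpha>) * (norm (y - x))\<^sup>2 \<le> J y"
      unfolding J_def D_def by (simp add: a_linear)
  next
    fix x h assume xh: "x \<in> X" "h \<in> X"
    have "((\<lambda>t. L2_inner M (T (\<lambda>s. \<psi> x s + t *\<^sub>R \<psi> h s)) (\<psi> h)) \<longlongrightarrow> L2_inner M (T (\<psi> x)) (\<psi> h)) (at_right 0)"
      using xh \<psi>_Linf Linf_L2 by (intro L2_inner_ray_continuous T) auto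
    moreover have "((\<lambda>t. a (x + t *\<^sub>R h) h / \<alpha> - a p h) \<longlongrightarrow> a x h / \<alpha> - a p h) (at_right 0)"
      using \<alpha> by (auto simp: a_linear intro!: tendsto_eq_intros)
    ultimately show "((\<lambda>t. D (x + t *\<^sub>R h) h) \<longlongrightarrow> D x h) (at_right 0)"
      unfolding D_def \<psi>_ray add_diff_eq[symmetric] by (rule tendsto_add)
  qed
  then obtain x where x: "x \<in> X" and crit: "\<And>h. h \<in> X \<Longrightarrow> D x h = 0" by blast
  \<comment> \<open>The equation is known for the chosen representative \<open>\<psi> h\<close>; any
    other \<open>w\<close> with the same lift agrees with it almost everywhere.\<close>
  have "L2_inner M (T (\<psi> x)) w + a x h / \<alpha> - a p h = 0" if "lifts h w" for h w
  proof -
    have h: "h \<in> X" using that unfolding X_def by blast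
    have "AE s in M. w s = \<psi> h s" using lifts_unique[OF that lifts_\<psi>[OF h]] .
    then have "L2_inner M w (T (\<psi> x)) = L2_inner M (\<psi> h) (T (\<psi> x))"
      using that lifts_\<psi>[OF h] Wh_L2 T(1)[OF \<psi>_Linf[OF x]] L2_space_measurable
      by (intro L2_inner_cong_AE) (auto simp: lifts_def)
    then show ?thesis using crit[OF h] unfolding D_def L2_inner_commute[of M "T (\<psi> x)"] by simp
  qed
  then show ?thesis using lifts_\<psi>[OF x] by blast
qed

section \<open>Existence and uniqueness for the abstract saddle point problem\<close>

definition "solution F \<alpha> \<psi>\<^sub>0 u \<psi> \<longleftrightarrow> u \<in> Vh \<and> \<psi> \<in> Wh \<and>
  (\<forall>v\<in>Vh. \<alpha> * a u v + b v (\<lambda>x. \<psi> x - \<psi>\<^sub>0 x) = \<alpha> * F v) \<and>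
  (\<forall>w\<in>Wh. b u w - L2_inner M (T \<psi>) w = 0)"

lemma solution_exists:
  assumes F: "bounded_linear F" and \<alpha>: "0 < \<alpha>" and \<psi>\<^sub>0: "\<psi>\<^sub>0 \<in> Wh"
  shows "\<exists>u \<psi>. solution F \<alpha> \<psi>\<^sub>0 u \<psi>"
proof -
  obtain f where f: "f \<in> Vh" "\<And>v. v \<in> Vh \<Longrightarrow> a f v = F v" using discrete_Riesz[OF F] by blast
  obtain x\<^sub>0 where x\<^sub>0: "lifts x\<^sub>0 \<psi>\<^sub>0" using lifts_exists[OF \<psi>\<^sub>0] by blast
  \<comment> \<open>The first equation, solved for the primal variable, reads
    \<open>u = p - (1 / \<alpha>) *\<^sub>R x\<close>. Inserted into the second, it yields the dual
    equation with this \<open>p\<close>.\<close>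
  define p where "p = f + (1 / \<alpha>) *\<^sub>R x\<^sub>0"
  obtain x \<psi> where x: "lifts x \<psi>"
    and crit: "\<And>h w. lifts h w \<Longrightarrow> L2_inner M (T \<psi>) w + a x h / \<alpha> - a p h = 0"
    using dual_problem_solvable[OF \<alpha>, of p] by blast
  define u where "u = p - (1 / \<alpha>) *\<^sub>R x"
  have u: "u \<in> Vh"
    unfolding u_def p_def using f(1) x x\<^sub>0 subspace_Vh
    by (intro subspace_diff subspace_add subspace_scale) (auto simp: lifts_def)
  have "\<alpha> * a u v + b v (\<lambda>s. \<psi> s - \<psi>\<^sub>0 s) = \<alpha> * F v" if v: "v \<in> Vh" for v
  proof -
    have "b v (\<lambda>s. \<psi> s - \<psi>\<^sub>0 s) = a x v - a x\<^sub>0 v"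
      using x x\<^sub>0 v Wh_L2 by (auto simp: lifts_def b_diff)
    moreover have "\<alpha> * a u v = \<alpha> * a f v + a x\<^sub>0 v - a x v"
      using \<alpha> by (simp add: u_def p_def a_linear distrib_left right_diff_distrib)
    ultimately show ?thesis using f(2)[OF v] by simp
  qed
  moreover have "b u w - L2_inner M (T \<psi>) w = 0" if w: "w \<in> Wh" for w
  proof -
    obtain h where h: "lifts h w" using lifts_exists[OF w] by blast
    then have "b u w = a u h" using u a(2)[of u h] unfolding lifts_def by simp
    then show ?thesis using crit[OF h] by (simp add: u_def a_linear)
  qed
  ultimately show ?thesis using u x unfolding solution_def lifts_def by blast
qed

text \<open>Testing the difference of the first equations with \<open>u' - u\<close> and that of the
  second with \<open>\<delta>\<close> makes \<open>\<alpha> * a (u' - u) (u' - u)\<close> the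
  negative of a monotone pairing, so \<open>u' = u\<close>. Then \<open>\<delta>\<close> annihilates
  \<open>Vh\<close>.\<close>

lemma solution_unique:
  assumes \<alpha>: "0 < \<alpha>" and \<psi>\<^sub>0: "\<psi>\<^sub>0 \<in> Wh"
    and sol: "solution F \<alpha> \<psi>\<^sub>0 u \<psi>" "solution F \<alpha> \<psi>\<^sub>0 u' \<psi>'"
  shows "u' = u" "AE x in M. \<psi>' x = \<psi> x"
proof -
  have mem: "u \<in> Vh" "u' \<in> Vh" "\<psi> \<in> Wh" "\<psi>' \<in> Wh"
    using sol unfolding solution_def by auto
  note L2 = mem(3,4)[THEN Wh_L2] \<psi>\<^sub>0[THEN Wh_L2]
  define \<delta> where "\<delta> x = \<psi>' x - \<psi> x" for x
  have \<delta>: "\<delta> \<in> Wh" unfolding \<delta>_def[abs_def] using mem by (intro Wh_diff)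
  have b\<delta>: "b v \<delta> = b v \<psi>' - b v \<psi>" for v
    unfolding \<delta>_def[abs_def] using L2 by (intro b_diff)
  have first: "\<alpha> * a (u' - u) v + b v \<delta> = 0" if "v \<in> Vh" for v
  proof -
    have "\<alpha> * a u v + b v \<psi> - b v \<psi>\<^sub>0 = \<alpha> * F v" "\<alpha> * a u' v + b v \<psi>' - b v \<psi>\<^sub>0 = \<alpha> * F v"
      using sol that L2 unfolding solution_def by (auto simp: b_diff)
    then show ?thesis by (simp add: b\<delta> a_linear algebra_simps)
  qed
  have "b (u' - u) \<delta> = b u' \<delta> - b u \<delta>"
    using linear_diff[OF bounded_linear.linear[OF bounded_linear_b[OF Wh_L2[OF \<delta>]]]] by simp
  also have "\<dots> = L2_inner M (T \<psi>') \<delta> - L2_inner M (T \<psi>) \<delta>"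
    using sol \<delta> unfolding solution_def by simp
  also have "\<dots> \<ge> 0"
  proof -
    have "\<psi> \<in> Linf_space M" "\<psi>' \<in> Linf_space M" using mem Wh(1) by auto
    \<comment> \<open>Adding the subgradient inequalities at \<psi> and \<psi>' cancels the
      potentials and leaves the monotonicity of \<open>T\<close>.\<close>
    then have "potential \<psi> + L2_inner M (T \<psi>) \<delta> \<le> potential \<psi>'"
      "potential \<psi>' + L2_inner M (T \<psi>') (\<lambda>x. (- 1) *\<^sub>R \<delta> x) \<le> potential \<psi>"
      using potential[of \<psi> \<psi>'] potential[of \<psi>' \<psi>] by (simp_all add: \<delta>_def[abs_def])
    then show ?thesis unfolding L2_inner_scale_right by simp
  qed
  finally have "0 \<le> b (u' - u) \<delta>" .
  moreover have "u' - u \<in> Vh" using mem subspace_Vh by (intro subspace_diff)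
  ultimately have "\<alpha> * a (u' - u) (u' - u) \<le> 0" using first[of "u' - u"] by simp
  then have "a (u' - u) (u' - u) \<le> 0" using \<alpha> by (simp add: mult_le_0_iff)
  then have "\<nu> * (norm (u' - u))\<^sup>2 \<le> 0" using a(4)[of "u' - u"] by simp
  then show "u' = u" using a(3) by (simp add: mult_le_0_iff)
  then have "b v \<delta> = 0" if "v \<in> Vh" for v
    using first[OF that] by (simp add: bilinear_lzero[OF a(1)])
  then have "AE x in M. \<delta> x = 0" using inf_sup[OF \<delta>] by blast
  then show "AE x in M. \<psi>' x = \<psi> x" by (simp add: \<delta>_def)
qed

end

section \<open>Reduction of the concrete problem to the abstract one\<close>

lemma inf_sup_constant_injective:
  assumes "0 < \<beta>" "ereal \<beta> < inf_sup_constant M \<iota> B Vh Wh" "w \<in> Wh"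
    and zero: "\<And>v. v \<in> Vh \<Longrightarrow> coupling_form M \<iota> B v w = 0"
  shows "AE x in M. w x = 0"
proof (rule ccontr)
  assume "\<not> (AE x in M. w x = 0)"
  then have "inf_sup_constant M \<iota> B Vh Wh \<le>
      (SUP v \<in> Vh - {0}. ereal (coupling_form M \<iota> B v w / (norm v * Q_dual_norm M \<iota> w)))"
    unfolding inf_sup_constant_def using assms(3) by (intro INF_lower) simp
  with assms(2) have "ereal \<beta> <
      (SUP v \<in> Vh - {0}. ereal (coupling_form M \<iota> B v w / (norm v * Q_dual_norm M \<iota> w)))"
    by (rule less_le_trans)
  \<comment> \<open>Such a quotient would have numerator \<open>0\<close>, and \<open>0\<close>
    divided by any real number is \<open>0\<close> and not above \<beta>.\<close>
  then obtain v where "v \<in> Vh" "\<beta> < coupling_form M \<iota> B v w / (norm v * Q_dual_norm M \<iota> w)"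
    unfolding less_SUP_iff by auto
  with zero[of v] assms(1) show False by simp
qed

theorem theorem3p1:
  fixes \<Omega> \<Omega>\<^sub>d :: "(real ^ 'n) set"
    and d :: real
    and M :: "(real ^ 'n) measure"
    and B :: "'v::{real_inner, complete_space} \<Rightarrow> 'q::{real_inner, complete_space}"
    and \<iota> :: "'q \<Rightarrow> (real ^ 'n \<Rightarrow> real ^ 'm)"
    and C :: "real ^ 'n \<Rightarrow> (real ^ 'm) set"
    and \<O> W :: "(real ^ 'n \<Rightarrow> real ^ 'm) set"
    and K :: "'v set"
    and a :: "'v \<Rightarrow> 'v \<Rightarrow> real"
    and \<nu> M\<^sub>a :: real
    and F :: "'v \<Rightarrow>\<^sub>L real"
    and R :: "real ^ 'n \<Rightarrow> real ^ 'm \<Rightarrow> ereal"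
    and Vh :: "'v set"
    and Wh :: "(real ^ 'n \<Rightarrow> real ^ 'm) set"
    and \<beta>\<^sub>0 :: real and \<beta>\<^sub>h :: ereal
    and k :: nat
    and \<alpha> :: "nat \<Rightarrow> real"
    and \<psi>_prev :: "real ^ 'n \<Rightarrow> real ^ 'm"
  assumes dim: "CARD('n) \<in> {1, 2, 3}"
    and domain: "polyhedral_domain \<Omega>"
    and Omega_d: "\<Omega>\<^sub>d \<subseteq> closure \<Omega>" "\<Omega>\<^sub>d \<in> sets (hausdorff_measure d)"
      "hausdorff_dim \<Omega>\<^sub>d = d" "d \<le> real CARD('n)"
      "emeasure (hausdorff_measure d) \<Omega>\<^sub>d < \<infinity>"
    and M: "M = restrict_space (hausdorff_measure d) \<Omega>\<^sub>d"
    and Q: "dense_L2_embedding M \<iota>"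
    and B: "bounded_linear B" "surj B"
    and C: "AE x in M. closed (C x) \<and> convex (C x) \<and> interior (C x) \<noteq> {}"
    and \<O>: "\<O> = feasible_observables M C"
    and K: "K = {v. \<iota> (B v) \<in> \<O>}" "closed K" "convex K" "K \<noteq> {}"
    and a: "bilinear a" "\<And>u v. a u v = a v u"
      "0 < \<nu>" "\<And>u. a u u \<ge> \<nu> * (norm u)\<^sup>2"
      "0 < M\<^sub>a" "\<And>u v. a u v \<le> M\<^sub>a * norm u * norm v"
    and W: "W = Linf_space M"
    and R: "Caratheodory_function M R"
      "AE x in M. Legendre_function (R x)"
      "AE x in M. effective_domain (R x) = C x"
      "AE x in M. ((\<lambda>y. R x y / ereal (norm y)) \<longlongrightarrow> \<infinity>) at_infinity"
    and R_superposition: "superposition R ` \<O> \<subseteq> L1_space M"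
      "continuous_wrt_norms (L2_norm M) (L1_norm M) \<O> (superposition R)"
    and grad_conj: "grad_conjugate R ` W \<subseteq> \<O>"
      "continuous_wrt_norms (Linf_norm M) (L2_norm M) W (grad_conjugate R)"
    and Vh: "fin_dim_subspace Vh"
    and Wh: "fin_dim_Linf_subspace M Wh"
    and inf_sup: "inf_sup_constant M \<iota> B Vh Wh = \<beta>\<^sub>h" "0 < \<beta>\<^sub>0" "ereal \<beta>\<^sub>0 < \<beta>\<^sub>h"
    and step: "1 \<le> k" "0 < \<alpha> k" "\<psi>_prev \<in> Wh"
  shows "\<exists>u\<in>Vh. \<exists>\<psi>\<in>Wh.
           solves_saddle_point M \<iota> B a F R Vh Wh (\<alpha> k) \<psi>_prev u \<psi> \<and>
           (\<forall>u'\<in>Vh. \<forall>\<psi>'\<in>Wh.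
              solves_saddle_point M \<iota> B a F R Vh Wh (\<alpha> k) \<psi>_prev u' \<psi>' \<longrightarrow>
              u' = u \<and> (AE x in M. \<psi>' x = \<psi> x))"
proof -
  \<comment> \<open>The total mass of \<open>M\<close> is the Hausdorff measure of
    \<open>\<Omega>\<^sub>d\<close>. Finiteness makes essentially bounded functions
    square-integrable.\<close>
  have fin: "finite_measure M"
    unfolding M using Omega_d
    by (intro finite_measureI)
       (simp add: space_restrict_space space_hausdorff_measure emeasure_restrict_space)
  interpret finite_measure M by (rule fin)
  have Legendre: "AE x in M. supercoercive_Legendre (R x)"
  proof -
    have "AE x in M. continuous_on (effective_domain (R x)) (R x)"
      using R(1) unfolding Caratheodory_function_def by blast
    with R(2-4) C show ?thesis
      by eventually_elim (simp add: supercoercive_Legendre_def)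
  qed
  define T where "T = grad_conjugate R"
  have T_O: "T w \<in> \<O>" if "w \<in> Linf_space M" for w
    using grad_conj(1) that unfolding T_def W by blast
  have T_L2: "T w \<in> L2_space M" if "w \<in> Linf_space M" for w
    using T_O[OF that] unfolding \<O> feasible_observables_def by blast
  \<comment> \<open>Almost everywhere this is the conjugate of \<open>R x\<close> at
    \<open>w x\<close>. Writing it through \<open>T w\<close> reduces its measurability and
    integrability to those of the two summands.\<close>
  define q where "q w x = w x \<bullet> T w x - superposition R (T w) x" for w x
  have q_integrable: "integrable M (q w)" if w: "w \<in> Linf_space M" for w
  proof -
    have "integrable M (superposition R (T w))"
      using R_superposition(1) T_O[OF w] unfolding L1_space_def by blast
    moreover have "integrable M (\<lambda>x. w x \<bullet> T w x)"
      using Linf_space_subset_L2_space w T_L2[OF w] by (intro L2_inner_integrable) auto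
    ultimately show ?thesis unfolding q_def by simp
  qed
  define pot where "pot w = integral\<^sup>L M (q w)" for w
  have pot: "pot w + L2_inner M (T w) (\<lambda>x. w' x - w x) \<le> pot w'"
    if w: "w \<in> Linf_space M" "w' \<in> Linf_space M" for w w'
  proof -
    have "(\<lambda>x. w' x - w x) \<in> L2_space M"
      using Linf_space_subset_L2_space w by (intro L2_space_diff) auto
    then have int: "integrable M (\<lambda>x. T w x \<bullet> (w' x - w x))"
      using T_L2[OF w(1)] by (intro L2_inner_integrable)
    have "AE x in M. q w x + T w x \<bullet> (w' x - w x) \<le> q w' x"
      using Legendre
      by eventually_elim
        (use supercoercive_Legendre.conjugate_subgradient in
          \<open>auto simp: q_def T_def superposition_def grad_conjugate_def\<close>)
    then have "(\<integral>x. q w x + T w x \<bullet> (w' x - w x) \<partial>M) \<le> integral\<^sup>L M (q w')"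
      using int q_integrable w by (intro integral_mono_AE) auto
    then show ?thesis
      unfolding pot_def L2_inner_def using int q_integrable[OF w(1)] by simp
  qed
  interpret discrete_saddle_point M \<iota> B a \<nu> M\<^sub>a T pot Vh Wh
  proof (intro discrete_saddle_point.intro discrete_saddle_point_axioms.intro fin)
    show "continuous_wrt_norms (Linf_norm M) (L2_norm M) (Linf_space M) T"
      using grad_conj(2) unfolding W T_def .
    show "AE x in M. w x = 0" if "w \<in> Wh" "\<And>v. v \<in> Vh \<Longrightarrow> coupling_form M \<iota> B v w = 0" for w
      using inf_sup that by (intro inf_sup_constant_injective) auto
  qed (fact Q B a T_L2 pot Vh fin_dim_Linf_subspace_closed[OF Wh])+
  have sol: "solution F (\<alpha> k) \<psi>_prev u \<psi> \<longleftrightarrow> u \<in> Vh \<and> \<psi> \<in> Wh \<and>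
      solves_saddle_point M \<iota> B a F R Vh Wh (\<alpha> k) \<psi>_prev u \<psi>" for u \<psi>
    unfolding solution_def unfolding T_def solves_saddle_point_def by blast
  obtain u \<psi> where u: "solution F (\<alpha> k) \<psi>_prev u \<psi>"
    using solution_exists[OF blinfun.bounded_linear_right step(2,3)] by blast
  show ?thesis
    using u solution_unique[OF step(2,3) u] unfolding sol by blast
qed

end
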